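(* Let $G$ be an analytic digraph on a Hausdorff space $X$. Then exactly one of the following holds: (1) $\chi_B(G)\le 2$. (2) There exists an odd pair $b=(c,d)$ of length $\aleph_0$ such that there is a continuous homomorphism from $\vec L_b$ to $G$. Moreover, for any $f\in\mathbb N^{\mathbb N}$, the pair $b=(c,d)$ in (2) can be chosen so that for every $i\in\mathbb N$ we have $\Sigma(d(i))>f(i)\cdot\sum_{j<i}|\Sigma(d(j))|$.
   Context: A digraph on a set $X$ is an irreflexive set $G\subseteq X^2$. $G$ is analytic if it is a continuous image of $\mathbb N^{\mathbb N}$ (as a subspace of $X^2$). A $\kappa$-coloring of $G$ is a map $c\colon X\to\kappa$ with $c(x)\ne c(y)$ whenever $(x,y)\in G$; $\chi_B(G)$ is the least cardinal $\kappa$ carrying a standard Borel structure such that $G$ has a $\kappa$-coloring that is Borel (with respect to the Borel $\sigma$-algebra of $X$). A homomorphism from a digraph $H$ on $Y$ to $G$ is a map $\phi$ with $(x,y)\in H\Rightarrow(\phi(x),\phi(y))\in G$. For an ordered pair, $(x,y)^1=(x,y)$ and $(x,y)^{-1}=(y,x)$. For a finite sequence $e$ of $\pm1$'s, $\Sigma(e)=\sum_{i}e(i)$ and $|e|$ is its length. An odd pair of length $\aleph_0$ is a pair $b=(c,d)$ with $c\colon\mathbb N\to 2\mathbb N+1$ and $d\colon\mathbb N\to\{-1,1\}^{<\mathbb N}$ with $|d(k)|=c(k)+2$ for all $k$. For $n\in\mathbb N$ let $X_{c,n}=\bigcup_{m\le n}\{0,\dots,c(m)\}\times 2^{n-m}$,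 whose elements are written as finite sequences $(k)^\frown t$ with $k\le c(m)$, $t\in 2^{n-m}$. Let $s_0=(c(0))$ and, for $n>0$, $s_n=(0,\dots,0,1)$ ($n$ zeros followed by $1$). For $N\in\mathbb N$ and $e\in\{-1,1\}^{k}$, $k>N$, let $\vec L^{e}_N$ be the oriented graph on $\{(0),\dots,(N)\}$ containing $((i),(j))^{e(\max(i,j))}$ whenever $|i-j|=1$. Let $\vec L_{b,0}=\vec L^{d(0)}_{c(0)}$ and let $\vec L_{b,n+1}$ be the oriented graph on $X_{c,n+1}$ whose edges are: $(v_0{}^\frown(j),v_1{}^\frown(j))$ for $j<2$ and $(v_0,v_1)\in\vec L_{b,n}$; the edges of $\vec L^{d(n+1)}_{c(n+1)}$; and the two edges $(s_n{}^\frown(0),(0))^{d(n+1)(0)}$ and $((c(n+1)),s_n{}^\frown(1))^{d(n+1)(c(n+1)+1)}$. Let $X_c=\{(n,k,r)\in\mathbb N\times\mathbb N\times 2^{\mathbb N}:k\le c(n)\}$ with the subspace topology of $\mathbb N\times\mathbb N\times 2^{\mathbb N}$, and for $m\le n$ let $\pi_{c,n}(m,k,r)=(k)^\frown(r|(n-m))\in X_{c,n}$. Finally $\vec L_b$ is the oriented graph on $X_c$ consisting of all pairs $((n_0,k_0,r_0),(n_1,k_1,r_1))$ such that $(\pi_{c,n}(n_0,k_0,r_0),\pi_{c,n}(n_1,k_1,r_1))\in\vec L_{b,n}$ for all $n\ge\max(n_0,n_1)$. *)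

theory Defs
  imports "HOL-Analysis.Analysis"
begin

section \<open>Digraphs and Borel colorings\<close>

type_synonym 'a digraph = "('a \<times> 'a) set"

definition analytic_set :: "'a::topological_space set \<Rightarrow> bool" where
  "analytic_set A \<longleftrightarrow>
     (\<exists>g :: (nat \<Rightarrow> nat) \<Rightarrow> 'a. continuous_on UNIV g \<and> range g = A)"

definition digraph_hom :: "'b digraph \<Rightarrow> 'a digraph \<Rightarrow> ('b \<Rightarrow> 'a) \<Rightarrow> bool" where
  "digraph_hom H G \<phi> \<longleftrightarrow> (\<forall>(x, y) \<in> H. (\<phi> x, \<phi> y) \<in> G)"

definition standard_borel :: "'k measure \<Rightarrow> bool" where
  "standard_borel M \<longleftrightarrow>
     (\<exists>T. topspace T = space M \<and> completely_metrizable_space T \<and> separable_space T \<and>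
          sets M = sigma_sets (topspace T) {U. openin T U})"

definition borel_coloring :: "'a::topological_space digraph \<Rightarrow> 'k measure \<Rightarrow> ('a \<Rightarrow> 'k) \<Rightarrow> bool" where
  "borel_coloring G M col \<longleftrightarrow>
     col \<in> measurable borel M \<and> (\<forall>(x, y) \<in> G. col x \<noteq> col y)"

text \<open>
  Cardinals are represented by cardinal orders, as in the library; \<open>\<kappa>\<close> has \<open>Field \<kappa>\<close> as its
  underlying set. A standard Borel space has at most continuum many points, so up to
  isomorphism every cardinal carrying a standard Borel structure lives on a set of reals.
\<close>

definition borel_colorable :: "'a::topological_space digraph \<Rightarrow> real rel \<Rightarrow> bool" where
  "borel_colorable G \<kappa> \<longleftrightarrow>
     (\<exists>M col. space M = Field \<kappa> \<and> standard_borel M \<and> borel_coloring G M col)"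

text \<open>
  \<open>\<chi>\<^sub>B(G) = \<kappa>\<close>, up to isomorphism of cardinal orders. This is a relation because no
  suitable cardinal need exist, in which case every bound on \<open>\<chi>\<^sub>B(G)\<close> is read as false.
\<close>

definition is_borel_chromatic_number :: "'a::topological_space digraph \<Rightarrow> real rel \<Rightarrow> bool" where
  "is_borel_chromatic_number G \<kappa> \<longleftrightarrow>
     Card_order \<kappa> \<and> borel_colorable G \<kappa> \<and>
     (\<forall>\<mu>. Card_order \<mu> \<longrightarrow> borel_colorable G \<mu> \<longrightarrow> (\<kappa>, \<mu>) \<in> ordLeq)"

definition borel_chromatic_number_le :: "'a::topological_space digraph \<Rightarrow> nat \<Rightarrow> bool" where
  "borel_chromatic_number_le G n \<longleftrightarrow>
     (\<exists>\<kappa>. is_borel_chromatic_number G \<kappa> \<and> (\<kappa>, natLeq_on n) \<in> ordLeq)"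

section \<open>The graphs of an odd pair\<close>

definition odd_pair :: "(nat \<Rightarrow> nat) \<Rightarrow> (nat \<Rightarrow> int list) \<Rightarrow> bool" where
  "odd_pair c d \<longleftrightarrow>
     (\<forall>k. odd (c k)) \<and> (\<forall>k. set (d k) \<subseteq> {-1, 1} \<and> length (d k) = c k + 2)"

text \<open>Meaningful for exponents \<open>1\<close> and \<open>-1\<close> only.\<close>

definition pair_pow :: "'a \<times> 'a \<Rightarrow> int \<Rightarrow> 'a \<times> 'a" where
  "pair_pow p e = (if e = 1 then p else prod.swap p)"

text \<open>
  Finite sequences are lists of naturals and \<open>2 = {0, 1}\<close>. \<open>X_fin c n\<close> is the vertex
  set \<open>X\<^bsub>c,n\<^esub>\<close> and \<open>X_lim c\<close> is \<open>X\<^sub>c\<close>.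
\<close>

definition X_fin :: "(nat \<Rightarrow> nat) \<Rightarrow> nat \<Rightarrow> nat list set" where
  "X_fin c n = (\<Union>m\<in>{..n}. {k # t | k t. k \<le> c m \<and> set t \<subseteq> {0, 1} \<and> length t = n - m})"

definition s_seq :: "(nat \<Rightarrow> nat) \<Rightarrow> nat \<Rightarrow> nat list" where
  "s_seq c n = (if n = 0 then [c 0] else replicate n 0 @ [1])"

text \<open>
  Each edge of the path is taken once, oriented relative to the direction from \<open>(i)\<close> to
  \<open>(i + 1)\<close>; its sign is the entry of \<open>e\<close> at \<open>max i (i + 1)\<close>.
\<close>

definition L_path :: "nat \<Rightarrow> int list \<Rightarrow> nat list digraph" where
  "L_path N e = {pair_pow ([i], [i + 1]) (e ! (i + 1)) | i. i < N}"

fun L_fin :: "(nat \<Rightarrow> nat) \<Rightarrow> (nat \<Rightarrow> int list) \<Rightarrow> nat \<Rightarrow> nat list digraph" where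
  "L_fin c d 0 = L_path (c 0) (d 0)"
| "L_fin c d (Suc n) =
     {(v\<^sub>0 @ [j], v\<^sub>1 @ [j]) | v\<^sub>0 v\<^sub>1 j. j < 2 \<and> (v\<^sub>0, v\<^sub>1) \<in> L_fin c d n}
     \<union> L_path (c (Suc n)) (d (Suc n))
     \<union> {pair_pow (s_seq c n @ [0], [0]) (d (Suc n) ! 0),
        pair_pow ([c (Suc n)], s_seq c n @ [1]) (d (Suc n) ! (c (Suc n) + 1))}"

lemma s_seq_in_X_fin:
  assumes "odd_pair c d"
  shows "s_seq c n \<in> X_fin c n"
proof (cases n)
  case 0
  then show ?thesis by (auto simp: s_seq_def X_fin_def)
next
  case (Suc m)
  then have "s_seq c n = 0 # (replicate m 0 @ [1])"
    by (simp add: s_seq_def)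
  then show ?thesis using Suc
    by (force simp: X_fin_def set_replicate_conv_if)
qed

lemma snoc_in_X_fin:
  assumes "v \<in> X_fin c n" "j < 2"
  shows "v @ [j] \<in> X_fin c (Suc n)"
proof -
  obtain m k t where v: "v = k # t" "m \<le> n" "k \<le> c m" "set t \<subseteq> {0, 1}" "length t = n - m"
    using assms(1) by (auto simp: X_fin_def)
  have "v @ [j] = k # (t @ [j])" "set (t @ [j]) \<subseteq> {0, 1}" "length (t @ [j]) = Suc n - m"
    using v assms(2) by auto
  with v show ?thesis unfolding X_fin_def by fastforce
qed

lemma L_path_subset:
  "L_path (c n) e \<subseteq> X_fin c n \<times> X_fin c n"
  by (fastforce simp: L_path_def X_fin_def pair_pow_def split: if_splits)

lemma L_fin_subset:
  assumes "odd_pair c d"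
  shows "L_fin c d n \<subseteq> X_fin c n \<times> X_fin c n"
proof (induction n)
  case 0
  then show ?case using L_path_subset[of c 0] by simp
next
  case (Suc n)
  have "[k] \<in> X_fin c (Suc n)" if "k \<le> c (Suc n)" for k
    using that by (force simp: X_fin_def)
  then show ?case
    using Suc snoc_in_X_fin[of _ c n] s_seq_in_X_fin[OF assms, of n] L_path_subset[of c "Suc n"]
    by (auto simp: pair_pow_def split: if_splits)
qed

definition X_lim :: "(nat \<Rightarrow> nat) \<Rightarrow> (nat \<times> nat \<times> (nat \<Rightarrow> nat)) set" where
  "X_lim c = {(n, k, r). k \<le> c n \<and> (\<forall>i. r i < 2)}"

text \<open>Independent of \<open>c\<close>; meant for points whose first coordinate is at most \<open>n\<close>.\<close>

definition proj :: "nat \<Rightarrow> nat \<times> nat \<times> (nat \<Rightarrow> nat) \<Rightarrow> nat list" where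
  "proj n = (\<lambda>(m, k, r). k # map r [0..<n - m])"

definition L_lim ::
    "(nat \<Rightarrow> nat) \<Rightarrow> (nat \<Rightarrow> int list) \<Rightarrow> (nat \<times> nat \<times> (nat \<Rightarrow> nat)) digraph" where
  "L_lim c d = {(x, y). x \<in> X_lim c \<and> y \<in> X_lim c \<and>
     (\<forall>n \<ge> max (fst x) (fst y). (proj n x, proj n y) \<in> L_fin c d n)}"

definition continuous_hom_from_L ::
    "(nat \<Rightarrow> nat) \<Rightarrow> (nat \<Rightarrow> int list) \<Rightarrow> 'a::topological_space digraph \<Rightarrow> bool" where
  "continuous_hom_from_L c d G \<longleftrightarrow>
     (\<exists>\<phi>. continuous_on (X_lim c) \<phi> \<and> digraph_hom (L_lim c d) G \<phi>)"

end

theory Submission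
  imports Defs "HOL-Probability.Infinite_Product_Measure" "HOL-Probability.Probability_Mass_Function"
begin

text \<open>
  Call a set of vertices small if it lies in a Borel union of components on which \<open>G\<close> has a Borel
  2-coloring. The small sets form a \<open>\<sigma>\<close>-ideal, and an analytic set that is
  not small contains, for every \<open>K\<close>, two points joined by a walk of odd length whose forward edges
  outnumber its backward edges by more than \<open>K\<close>.

  If \<open>G\<close> has no Borel 2-coloring, one builds approximations of a homomorphism level by level, keeping
  the set of possible images of the vertex \<open>s\<^sub>n\<close> from being small. Smallness is invariant under
  components and the finite graphs are connected, so no choice of vertex matters; and as there are
  only countably many ways to extend an approximation to the next level, one of them again gives a
  set that is not small.

  Conversely, the two points of the Cantor space that differ in one coordinate only are joined by
  an odd path in the limit graph. So a Borel 2-coloring would yield a set that every coordinate flip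
  maps to its complement, which the fair-coin measure excludes.
\<close>

section \<open>Analytic sets\<close>

text \<open>A Hausdorff space offers no diameters to shrink, and \<open>G\<close> need not be
  closed. The construction therefore works with codes in Baire space: every vertex and every edge of
  a finite graph receives its own code, and level \<open>n\<close> fixes the first \<open>n\<close>
  entries of each. The limit of the edge codes certifies that the limit pair lies in
  \<open>G\<close>, and the Hausdorff property identifies its ends with the images of the vertices.

  Odd walks of large sum exist because the sum of a walk has the parity of its length. If all walks
  between points of a set have sum at most 0, reversal makes every sum 0 and every length even, and
  such a set is small by separation in the bipartite double cover. A larger bound is lowered in
  steps of one: points from which the bound is attained have among themselves only walks of
  nonpositive sum, so they can be split off. Since the walk for a new level is chosen after all
  earlier sums are known, the growth condition on \<open>d\<close> comes along with the
  construction.\<close>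

definition cyl :: "nat list \<Rightarrow> (nat \<Rightarrow> nat) set" where
  "cyl s = {\<alpha>. \<forall>i<length s. \<alpha> i = s ! i}"

lemma open_agree:
  fixes r :: "nat \<Rightarrow> 'b::discrete_topology"
  shows "open {r'. \<forall>i<N. r' i = r i}"
proof -
  have "open ((\<lambda>r'::nat \<Rightarrow> 'b. r' i) -` {r i})" for i
    by (intro open_vimage continuous_on_product_coordinates) (rule open_discrete)
  then have "open (\<Inter>i\<in>{..<N}. (\<lambda>r'::nat \<Rightarrow> 'b. r' i) -` {r i})"
    by (intro open_INT) auto
  also have "(\<Inter>i\<in>{..<N}. (\<lambda>r'::nat \<Rightarrow> 'b. r' i) -` {r i}) = {r'. \<forall>i<N. r' i = r i}"
    by auto
  finally show ?thesis .
qed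

lemma open_contains_agree:
  fixes r :: "nat \<Rightarrow> 'b::topological_space"
  assumes "open V" "r \<in> V"
  shows "\<exists>N. \<forall>r'. (\<forall>i<N. r' i = r i) \<longrightarrow> r' \<in> V"
proof -
  have "openin (product_topology (\<lambda>i. euclidean) UNIV) V"
    using assms(1) by (simp add: open_fun_def)
  from product_topology_open_contains_basis[OF this assms(2)]
  obtain X where X: "r \<in> (\<Pi>\<^sub>E i\<in>UNIV. X i)" "finite {i. X i \<noteq> (UNIV::'b set)}"
    "(\<Pi>\<^sub>E i\<in>UNIV. X i) \<subseteq> V" by auto
  obtain N where N: "\<And>i. X i \<noteq> UNIV \<Longrightarrow> i < N"
    using X(2) unfolding finite_nat_set_iff_bounded by blast
  have "r' \<in> V" if "\<forall>i<N. r' i = r i" for r'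
  proof -
    have "r' i \<in> X i" for i
      using that N[of i] X(1) by (cases "X i = UNIV") (auto simp: PiE_def Pi_def)
    then show ?thesis using X(3) by auto
  qed
  then show ?thesis by blast
qed

lemma mem_cyl: "\<beta> \<in> cyl (map \<alpha> [0..<n]) \<longleftrightarrow> (\<forall>i<n. \<beta> i = \<alpha> i)"
  by (simp add: cyl_def)

lemma cyl_prefix: "\<alpha> \<in> cyl (map \<alpha> [0..<n])"
  by (simp add: mem_cyl)

lemma cyl_Nil [simp]: "cyl [] = UNIV"
  by (simp add: cyl_def)

lemma cyl_split: "cyl s = (\<Union>k. cyl (s @ [k]))"
  by (auto simp: cyl_def nth_append less_Suc_eq)

lemma open_cyl: "open (cyl s)"
  unfolding cyl_def by (rule open_agree)

lemma closed_cyl: "closed (cyl s)"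
proof -
  have "cyl s = (\<Inter>i\<in>{..<length s}. (\<lambda>\<alpha>. \<alpha> i) -` {s ! i})"
    by (auto simp: cyl_def)
  also have "closed \<dots>"
    by (intro closed_INT ballI closed_vimage closed_singleton continuous_on_product_coordinates)
  finally show ?thesis .
qed

lemma open_eq_UN_cyl:
  assumes "open V" shows "V = (\<Union>s\<in>{s. cyl s \<subseteq> V}. cyl s)"
proof
  show "V \<subseteq> (\<Union>s\<in>{s. cyl s \<subseteq> V}. cyl s)"
  proof
    fix \<alpha> assume "\<alpha> \<in> V"
    then obtain N where "\<forall>r'. (\<forall>i<N. r' i = \<alpha> i) \<longrightarrow> r' \<in> V"
      using open_contains_agree[OF assms] by blast
    then have "cyl (map \<alpha> [0..<N]) \<subseteq> V" by (auto simp: mem_cyl)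
    then show "\<alpha> \<in> (\<Union>s\<in>{s. cyl s \<subseteq> V}. cyl s)" using cyl_prefix by blast
  qed
qed auto

text \<open>Unlike \<^const>\<open>analytic_set\<close>, this includes the empty set, and closure properties need no
  retractions of Baire space onto closed subsets.\<close>

definition suslin :: "'a::topological_space set \<Rightarrow> bool" where
  "suslin A \<longleftrightarrow> (\<exists>(C :: (nat \<Rightarrow> nat) set) f. closed C \<and> continuous_on C f \<and> f ` C = A)"

lemma suslin_analytic: "analytic_set A \<Longrightarrow> suslin A"
  unfolding suslin_def analytic_set_def by (metis closed_UNIV)

lemma suslin_empty: "suslin {}"
  unfolding suslin_def by (metis closed_empty continuous_on_empty image_empty)

text \<open>The parameter space may be any continuous image of Baire space, since \<open>C\<close>
  pulls back to a closed set of sequences. Closed conditions on pairs or sequences of codes thus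
  still define Suslin sets.\<close>

lemma suslin_image_closed:
  fixes C :: "'z::topological_space set"
  assumes "analytic_set (UNIV :: 'z set)" "closed C" "continuous_on C f"
  shows "suslin (f ` C)"
proof -
  obtain q :: "(nat \<Rightarrow> nat) \<Rightarrow> 'z" where q: "continuous_on UNIV q" "range q = UNIV"
    using assms(1) unfolding analytic_set_def by blast
  have "closed (q -` C)" using q(1) assms(2) by (simp add: closed_vimage)
  moreover have "continuous_on (q -` C) (f \<circ> q)"
    by (rule continuous_on_compose) (auto intro: continuous_on_subset q assms)
  moreover have "(f \<circ> q) ` (q -` C) = f ` C"
    using q(2) by (metis image_comp surj_image_vimage_eq)
  ultimately show ?thesis unfolding suslin_def by (intro exI[of _ "q -` C"] exI[of _ "f \<circ> q"] conjI)
qed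

lemma analytic_UNIV_baire: "analytic_set (UNIV :: (nat \<Rightarrow> nat) set)"
  unfolding analytic_set_def by (rule exI[of _ id]) (simp add: continuous_on_id)

lemma analytic_UNIV_prod:
  "analytic_set (UNIV :: ((nat \<Rightarrow> nat) \<times> (nat \<Rightarrow> nat)) set)"
  unfolding analytic_set_def
proof (intro exI conjI)
  let ?q = "\<lambda>\<alpha>::nat\<Rightarrow>nat. (\<lambda>i. \<alpha> (2 * i), \<lambda>i. \<alpha> (2 * i + 1))"
  show "continuous_on UNIV ?q"
    by (intro continuous_intros continuous_on_product_coordinates)
  have "p \<in> range ?q" for p :: "(nat \<Rightarrow> nat) \<times> (nat \<Rightarrow> nat)"
  proof -
    have "p = ?q (\<lambda>i. if even i then fst p (i div 2) else snd p (i div 2))"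
      by (cases p) auto
    then show ?thesis by (rule range_eqI[where f = ?q])
  qed
  then show "range ?q = UNIV" by blast
qed

lemma analytic_UNIV_fun:
  "analytic_set (UNIV :: ('i::countable \<Rightarrow> nat \<Rightarrow> nat) set)"
  unfolding analytic_set_def
proof (intro exI conjI)
  let ?q = "\<lambda>(\<alpha>::nat\<Rightarrow>nat) (i::'i) (k::nat). \<alpha> (to_nat (i, k))"
  show "continuous_on UNIV ?q"
    by (intro continuous_on_coordinatewise_then_product continuous_on_product_coordinates)
  have "p \<in> range ?q" for p :: "'i \<Rightarrow> nat \<Rightarrow> nat"
    by (rule range_eqI[of _ _ "\<lambda>m. case_prod p (from_nat m)"]) (simp add: fun_eq_iff)
  then show "range ?q = UNIV" by (intro equalityI subsetI UNIV_I)
qed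

lemma suslin_image:
  assumes "suslin A" "continuous_on A f"
  shows "suslin (f ` A)"
proof -
  obtain C :: "(nat \<Rightarrow> nat) set" and h where "closed C" "continuous_on C h" "h ` C = A"
    using assms(1) unfolding suslin_def by blast
  moreover from this have "continuous_on C (f \<circ> h)"
    using assms(2) by (blast intro: continuous_on_compose)
  ultimately show ?thesis unfolding suslin_def
    by (intro exI[of _ C] exI[of _ "f \<circ> h"]) (metis image_comp)
qed

text \<open>The first entry of a code selects the index \<open>n\<close>, and the tail is a code for
  \<open>A n\<close>. As each \<open>E n\<close> is open, closedness of \<open>D\<close> and
  continuity of \<open>f\<close> can be checked for one index at a time.\<close>

lemma suslin_UN_nat:
  fixes A :: "nat \<Rightarrow> 'a::topological_space set"
  assumes "\<And>n. suslin (A n)"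
  shows "suslin (\<Union>n. A n)"
proof -
  obtain C :: "nat \<Rightarrow> (nat \<Rightarrow> nat) set" and h
    where C: "\<And>n. closed (C n)" "\<And>n. continuous_on (C n) (h n)" "\<And>n. h n ` C n = A n"
    using assms unfolding suslin_def by metis
  define tl' :: "(nat \<Rightarrow> nat) \<Rightarrow> nat \<Rightarrow> nat" where "tl' \<alpha> = (\<lambda>i. \<alpha> (Suc i))" for \<alpha>
  have ctl: "continuous_on S tl'" for S
    unfolding tl'_def by (rule continuous_on_subset[where s=UNIV])
      (intro continuous_on_coordinatewise_then_product continuous_on_product_coordinates, simp)
  define E :: "nat \<Rightarrow> (nat \<Rightarrow> nat) set" where "E n = cyl [n]" for n
  have E: "\<alpha> \<in> E n \<longleftrightarrow> \<alpha> 0 = n" for \<alpha> n by (auto simp: E_def cyl_def)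
  have oE: "open (E n)" for n by (simp add: E_def open_cyl)
  define D where "D = {\<alpha>. tl' \<alpha> \<in> C (\<alpha> 0)}"
  define f where "f \<alpha> = h (\<alpha> 0) (tl' \<alpha>)" for \<alpha>
  have "- D = (\<Union>n. E n \<inter> tl' -` (- C n))" by (auto simp: D_def E)
  moreover have "open (E n \<inter> tl' -` (- C n))" for n
    by (intro open_Int oE open_vimage ctl) (simp add: C open_Compl)
  ultimately have "closed D" unfolding closed_def by (simp only:) (rule open_UN, blast)
  moreover have "continuous_on D f"
    unfolding continuous_on_open_invariant
  proof (intro allI impI)
    fix B :: "'a set" assume B: "open B"
    have "\<exists>W. open W \<and> W \<inter> (D \<inter> E n) = f -` B \<inter> (D \<inter> E n)" for n
    proof -
      have "continuous_on (D \<inter> E n) (\<lambda>\<alpha>. h n (tl' \<alpha>))"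
        by (rule continuous_on_compose2[OF C(2)[of n] ctl]) (auto simp: D_def E)
      then have "continuous_on (D \<inter> E n) f"
        by (rule continuous_on_eq) (auto simp: f_def E)
      then show ?thesis using B unfolding continuous_on_open_invariant by blast
    qed
    then obtain W where W: "\<And>n. open (W n)" "\<And>n. W n \<inter> (D \<inter> E n) = f -` B \<inter> (D \<inter> E n)"
      by metis
    have "open (\<Union>n. W n \<inter> E n)" using W oE by blast
    moreover have "(\<Union>n. W n \<inter> E n) \<inter> D = f -` B \<inter> D"
    proof (rule set_eqI)
      fix \<alpha>
      have "\<alpha> \<in> (\<Union>n. W n \<inter> E n) \<inter> D \<longleftrightarrow> \<alpha> \<in> W (\<alpha> 0) \<inter> (D \<inter> E (\<alpha> 0))" by (auto simp: E)
      also have "\<dots> \<longleftrightarrow> \<alpha> \<in> f -` B \<inter> D" unfolding W(2) by (auto simp: E)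
      finally show "\<alpha> \<in> (\<Union>n. W n \<inter> E n) \<inter> D \<longleftrightarrow> \<alpha> \<in> f -` B \<inter> D" .
    qed
    ultimately show "\<exists>W. open W \<and> W \<inter> D = f -` B \<inter> D" by blast
  qed
  moreover have "f ` D = (\<Union>n. A n)"
  proof
    show "f ` D \<subseteq> (\<Union>n. A n)" by (auto simp: f_def D_def C(3)[symmetric])
    show "(\<Union>n. A n) \<subseteq> f ` D"
    proof
      fix x assume "x \<in> (\<Union>n. A n)"
      then obtain n \<beta> where "\<beta> \<in> C n" "x = h n \<beta>" by (auto simp: C(3)[symmetric])
      then have "case_nat n \<beta> \<in> D" "f (case_nat n \<beta>) = x"
        by (auto simp: D_def f_def tl'_def)
      then show "x \<in> f ` D" by blast
    qed
  qed
  ultimately show ?thesis unfolding suslin_def by (intro exI[of _ D] exI[of _ f] conjI)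
qed

lemma suslin_UN:
  assumes "countable I" "\<And>i. i \<in> I \<Longrightarrow> suslin (A i)"
  shows "suslin (\<Union>i\<in>I. A i)"
proof (cases "I = {}")
  case False
  then have "\<And>n. suslin (A (from_nat_into I n))"
    using assms(2) from_nat_into by metis
  then have "suslin (\<Union>n. A (from_nat_into I n))"
    by (rule suslin_UN_nat)
  also have "(\<Union>n. A (from_nat_into I n)) = (\<Union>i\<in>range (from_nat_into I). A i)"
    by simp
  also have "\<dots> = (\<Union>i\<in>I. A i)"
    using range_from_nat_into[OF False assms(1)] by (simp only:)
  finally show ?thesis .
qed (simp add: suslin_empty)

lemma suslin_Un: "suslin A \<Longrightarrow> suslin B \<Longrightarrow> suslin (A \<union> B)"
  using suslin_UN_nat[of "\<lambda>n. if n = 0 then A else B"]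
  by (rule back_subst) (auto split: if_splits)

text \<open>A common point is given by one code for each \<open>A n\<close>, all with the same
  value; in a Hausdorff space this coincidence is a closed condition on the sequence of
  codes.\<close>

lemma suslin_INT_nat:
  fixes A :: "nat \<Rightarrow> 'a::t2_space set"
  assumes "\<And>n. suslin (A n)"
  shows "suslin (\<Inter>n. A n)"
proof -
  obtain C :: "nat \<Rightarrow> (nat \<Rightarrow> nat) set" and h
    where C: "\<And>n. closed (C n)" "\<And>n. continuous_on (C n) (h n)" "\<And>n. h n ` C n = A n"
    using assms unfolding suslin_def by metis
  define Z where "Z = (\<Inter>n. (\<lambda>a::nat\<Rightarrow>nat\<Rightarrow>nat. a n) -` C n)"
  have cZ: "closed Z" unfolding Z_def
    by (intro closed_INT ballI closed_vimage C continuous_on_product_coordinates)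
  have ch: "continuous_on Z (\<lambda>a. h n (a n))" for n
    by (rule continuous_on_compose2[OF C(2)[of n]])
      (auto simp: Z_def intro: continuous_on_subset[OF continuous_on_product_coordinates])
  define D where "D = Z \<inter> (\<Inter>n. Z \<inter> (\<lambda>a. (h n (a n), h 0 (a 0))) -` {y. \<exists>x. y = (x, x)})"
  have "closed D" unfolding D_def
    by (intro closed_Int closed_INT ballI cZ continuous_closed_preimage closed_diagonal
        continuous_on_Pair ch)
  then have "suslin ((\<lambda>a. h 0 (a 0)) ` D)"
    by (intro suslin_image_closed analytic_UNIV_fun)
      (auto intro: continuous_on_subset[OF ch] simp: D_def)
  also have "(\<lambda>a. h 0 (a 0)) ` D = (\<Inter>n. A n)"
  proof (intro set_eqI iffI)
    fix x assume "x \<in> (\<Inter>n. A n)"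
    then have "x \<in> h n ` C n" for n by (simp add: C(3))
    then have "\<forall>n. \<exists>\<alpha>. \<alpha> \<in> C n \<and> h n \<alpha> = x" by (simp add: image_iff) metis
    then obtain a where "\<And>n. a n \<in> C n \<and> h n (a n) = x" by metis
    then have "a \<in> D" "x = h 0 (a 0)" by (auto simp: D_def Z_def)
    then show "x \<in> (\<lambda>a. h 0 (a 0)) ` D" by blast
  next
    fix x assume "x \<in> (\<lambda>a. h 0 (a 0)) ` D"
    then obtain a where a: "a \<in> D" "x = h 0 (a 0)" by blast
    then have "x = h n (a n)" "a n \<in> C n" for n by (auto simp: D_def Z_def)
    then show "x \<in> (\<Inter>n. A n)" using C(3) by blast
  qed
  finally show ?thesis .
qed

lemma suslin_Int:
  fixes A B :: "'a::t2_space set"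
  assumes "suslin A" "suslin B"
  shows "suslin (A \<inter> B)"
proof -
  have "suslin (\<Inter>n::nat. if n = 0 then A else B)"
    by (rule suslin_INT_nat) (simp add: assms)
  also have "(\<Inter>n::nat. if n = 0 then A else B) = A \<inter> B" by (auto split: if_splits)
  finally show ?thesis .
qed

text \<open>An open set of codes is a countable union of cylinders, which are also closed. For the
  part outside \<open>U\<close> the relevant codes already form a closed set.\<close>

lemma suslin_Int_open:
  assumes "suslin A" "open U"
  shows "suslin (A \<inter> U)" and "suslin (A - U)"
proof -
  obtain C :: "(nat \<Rightarrow> nat) set" and h where C: "closed C" "continuous_on C h" "h ` C = A"
    using assms(1) unfolding suslin_def by blast
  obtain V where V: "open V" "V \<inter> C = h -` U \<inter> C"
    using C(2) assms(2) unfolding continuous_on_open_invariant by blast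
  have "A \<inter> U = h ` (V \<inter> C)" unfolding V(2) using C(3) by blast
  also have "\<dots> = (\<Union>s\<in>{s. cyl s \<subseteq> V}. h ` (cyl s \<inter> C))"
    by (subst open_eq_UN_cyl[OF V(1)]) blast
  finally show "suslin (A \<inter> U)"
    by (simp only:) (auto intro!: suslin_UN suslin_image_closed analytic_UNIV_baire
        C closed_Int closed_cyl intro: continuous_on_subset[OF C(2)])
  have "A - U = h ` (C - V)" using V(2) C(3) by blast
  then show "suslin (A - U)"
    by (auto intro!: suslin_image_closed analytic_UNIV_baire C closed_Diff V
        intro: continuous_on_subset[OF C(2)])
qed

text \<open>Complementation exchanges the two claims, so they pass through the generation of the
  Borel sets together.\<close>

lemma suslin_borel:
  fixes A B :: "'a::t2_space set"
  assumes "suslin A" "B \<in> sets borel"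
  shows suslin_Int_borel: "suslin (A \<inter> B)" and suslin_Diff_borel: "suslin (A - B)"
proof -
  have "B \<in> sigma_sets UNIV {U. open U}" using assms(2) by (simp add: borel_def)
  then have "\<forall>A. suslin A \<longrightarrow> suslin (A \<inter> B) \<and> suslin (A - B)"
  proof induction
    case (Basic U) then show ?case using suslin_Int_open by auto
  next
    case Empty then show ?case by (auto simp: suslin_empty)
  next
    case (Compl U)
    have "X \<inter> (UNIV - U) = X - U" "X - (UNIV - U) = X \<inter> U" for X by auto
    then show ?case using Compl.IH by simp
  next
    case (Union U)
    have eq: "X \<inter> \<Union>(range U) = (\<Union>n. X \<inter> U n)" "X - \<Union>(range U) = (\<Inter>n. X - U n)" for X by auto
    show ?case
    proof (intro allI impI conjI)
      fix A :: "'a set" assume "suslin A"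
      then have U: "suslin (A \<inter> U n)" "suslin (A - U n)" for n using Union.IH by blast+
      show "suslin (A \<inter> \<Union>(range U))" unfolding eq by (rule suslin_UN_nat) (rule U)
      show "suslin (A - \<Union>(range U))" unfolding eq by (rule suslin_INT_nat) (rule U)
    qed
  qed
  then show "suslin (A \<inter> B)" "suslin (A - B)" using assms(1) by blast+
qed

text \<open>A point of the image is given by a code for a point of \<open>W\<close> and a code for a
  pair in \<open>Q\<close> starting there; this matching is a closed condition.\<close>

lemma suslin_Image:
  fixes Q :: "('a::t2_space \<times> 'a) set"
  assumes "suslin Q" "suslin W"
  shows "suslin (Q `` W)"
proof -
  obtain C :: "(nat \<Rightarrow> nat) set" and q where C: "closed C" "continuous_on C q" "q ` C = Q"
    using assms(1) unfolding suslin_def by blast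
  obtain E :: "(nat \<Rightarrow> nat) set" and w where E: "closed E" "continuous_on E w" "w ` E = W"
    using assms(2) unfolding suslin_def by blast
  define D where "D = (E \<times> C) \<inter> (\<lambda>(\<alpha>, \<beta>). (w \<alpha>, fst (q \<beta>))) -` {y. \<exists>x. y = (x, x)}"
  have w: "continuous_on (E \<times> C) (\<lambda>p. w (fst p))"
    by (rule continuous_on_compose2[OF E(2)]) (auto intro!: continuous_on_fst continuous_on_id)
  have q: "continuous_on (E \<times> C) (\<lambda>p. q (snd p))"
    by (rule continuous_on_compose2[OF C(2)]) (auto intro!: continuous_on_snd continuous_on_id)
  have "closed D" unfolding D_def split_def
    by (intro continuous_closed_preimage closed_diagonal closed_Times E C
        continuous_on_Pair continuous_on_fst w q)
  then have "suslin ((\<lambda>p. snd (q (snd p))) ` D)"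
    by (intro suslin_image_closed analytic_UNIV_prod continuous_on_snd)
      (auto intro: continuous_on_subset[OF q] simp: D_def)
  also have "(\<lambda>p. snd (q (snd p))) ` D = Q `` W"
  proof (intro set_eqI iffI)
    fix y assume "y \<in> Q `` W"
    then obtain x where "x \<in> W" "(x, y) \<in> Q" by blast
    then obtain \<alpha> \<beta> where "\<alpha> \<in> E" "w \<alpha> = x" "\<beta> \<in> C" "q \<beta> = (x, y)"
      unfolding C(3)[symmetric] E(3)[symmetric] by auto
    then have "(\<alpha>, \<beta>) \<in> D" "y = snd (q (snd (\<alpha>, \<beta>)))" by (auto simp: D_def)
    then show "y \<in> (\<lambda>p. snd (q (snd p))) ` D" by (metis image_eqI)
  next
    fix y assume "y \<in> (\<lambda>p. snd (q (snd p))) ` D"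
    then obtain \<alpha> \<beta> where "\<alpha> \<in> E" "\<beta> \<in> C" "w \<alpha> = fst (q \<beta>)" "y = snd (q \<beta>)"
      by (auto simp: D_def)
    then have "w \<alpha> \<in> W" "(w \<alpha>, y) = q \<beta>" "q \<beta> \<in> Q"
      using C(3) E(3) by (blast, simp, blast)
    then show "y \<in> Q `` W" by (metis ImageI)
  qed
  finally show ?thesis .
qed

text \<open>Lusin's separation theorem. Separating sets for countably many pieces combine, so an
  inseparable pair has an inseparable pair of smaller cylinder pieces. Iteration gives two branches
  with distinct values, and disjoint neighborhoods of these values separate all sufficiently small
  pieces.\<close>

lemma borel_separation:
  fixes A B :: "'a::t2_space set"
  assumes "suslin A" "suslin B" "A \<inter> B = {}"
  shows "\<exists>C\<in>sets borel. A \<subseteq> C \<and> C \<inter> B = {}"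
proof (rule ccontr)
  define sep where "sep A B \<longleftrightarrow> (\<exists>C\<in>sets borel. A \<subseteq> C \<and> C \<inter> B = {})" for A B :: "'a set"
  have sep_UN: "sep (\<Union>i::nat. F i) (\<Union>j::nat. H j)" if sp: "\<And>i j. sep (F i) (H j)" for F H
  proof -
    obtain C where C: "\<And>i j. C i j \<in> sets borel" "\<And>i j. F i \<subseteq> C i j" "\<And>i j. C i j \<inter> H j = {}"
      using sp unfolding sep_def by metis
    show ?thesis unfolding sep_def
    proof (intro bexI conjI)
      show "(\<Union>i. \<Inter>j. C i j) \<in> sets borel" using C(1) by (intro sets.countable_UN sets.countable_INT) auto
      show "(\<Union>i. F i) \<subseteq> (\<Union>i. \<Inter>j. C i j)" using C(2) by blast
      show "(\<Union>i. \<Inter>j. C i j) \<inter> (\<Union>j. H j) = {}" using C(3) by blast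
    qed
  qed
  assume "\<not> ?thesis"
  then have nsep: "\<not> sep A B" by (simp add: sep_def)
  obtain C :: "(nat \<Rightarrow> nat) set" and f where C: "closed C" "continuous_on C f" "f ` C = A"
    using assms(1) unfolding suslin_def by blast
  obtain D :: "(nat \<Rightarrow> nat) set" and h where D: "closed D" "continuous_on D h" "h ` D = B"
    using assms(2) unfolding suslin_def by blast
  define P where "P n x \<longleftrightarrow> (case x of (s, t) \<Rightarrow> length s = n \<and> length t = n \<and>
    \<not> sep (f ` (cyl s \<inter> C)) (h ` (cyl t \<inter> D)))" for n :: nat and x :: "nat list \<times> nat list"
  define Q where "Q n x y \<longleftrightarrow> (\<exists>i j. y = (fst x @ [i], snd x @ [j]))"
    for n :: nat and x y :: "nat list \<times> nat list"
  have "\<exists>F. \<forall>n. P n (F n) \<and> Q n (F n) (F (Suc n))"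
  proof (rule dependent_nat_choice)
    show "\<exists>x. P 0 x" using nsep C D by (auto simp: P_def)
  next
    fix x n assume "P n x"
    then obtain s t where x: "x = (s, t)" "length s = n" "length t = n"
      "\<not> sep (f ` (cyl s \<inter> C)) (h ` (cyl t \<inter> D))" by (auto simp: P_def)
    have "f ` (cyl s \<inter> C) = (\<Union>i. f ` (cyl (s @ [i]) \<inter> C))"
      by (subst cyl_split) blast
    moreover have "h ` (cyl t \<inter> D) = (\<Union>i. h ` (cyl (t @ [i]) \<inter> D))"
      by (subst cyl_split) blast
    moreover have "sep (\<Union>i. f ` (cyl (s @ [i]) \<inter> C)) (\<Union>j. h ` (cyl (t @ [j]) \<inter> D))"
      if "\<And>i j. sep (f ` (cyl (s @ [i]) \<inter> C)) (h ` (cyl (t @ [j]) \<inter> D))"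
      by (rule sep_UN) (rule that)
    ultimately obtain i j where "\<not> sep (f ` (cyl (s @ [i]) \<inter> C)) (h ` (cyl (t @ [j]) \<inter> D))"
      using x(4) by auto
    then show "\<exists>y. P (Suc n) y \<and> Q n x y"
      using x by (intro exI[of _ "(s @ [i], t @ [j])"]) (auto simp: P_def Q_def)
  qed
  then obtain F where F: "\<And>n. P n (F n)" "\<And>n. Q n (F n) (F (Suc n))" by blast
  define s where "s n = fst (F n)" for n
  define t where "t n = snd (F n)" for n
  have st: "length (s n) = n" "length (t n) = n"
    "\<not> sep (f ` (cyl (s n) \<inter> C)) (h ` (cyl (t n) \<inter> D))" for n
    using F(1)[of n] by (auto simp: P_def s_def t_def split: prod.splits)
  have ssuc: "take n (s (Suc n)) = s n" and tsuc: "take n (t (Suc n)) = t n" for n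
    using F(2)[of n] st(1,2)[of n] by (auto simp: Q_def s_def t_def)
  define \<alpha> where "\<alpha> i = s (Suc i) ! i" for i
  define \<beta> where "\<beta> i = t (Suc i) ! i" for i
  have \<alpha>: "s n = map \<alpha> [0..<n]" for n
  proof (induction n)
    case (Suc n)
    have "s (Suc n) = take n (s (Suc n)) @ [s (Suc n) ! n]"
      using st(1)[of "Suc n"] take_Suc_conv_app_nth[of n "s (Suc n)"] by simp
    then show ?case using Suc ssuc by (simp add: \<alpha>_def)
  qed (use st(1,2)[of 0] in simp)
  have \<beta>: "t n = map \<beta> [0..<n]" for n
  proof (induction n)
    case (Suc n)
    have "t (Suc n) = take n (t (Suc n)) @ [t (Suc n) ! n]"
      using st(2)[of "Suc n"] take_Suc_conv_app_nth[of n "t (Suc n)"] by simp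
    then show ?case using Suc tsuc by (simp add: \<beta>_def)
  qed (use st(1,2)[of 0] in simp)
  have sep_empty: "sep {} X" "sep X {}" for X
    unfolding sep_def by (rule bexI[of _ "{}"], simp, simp) (rule bexI[of _ UNIV], simp, simp)
  have limC: "\<gamma> \<in> Z" if Z: "closed Z" "\<And>n. cyl (map \<gamma> [0..<n]) \<inter> Z \<noteq> {}" for \<gamma> and Z :: "(nat \<Rightarrow> nat) set"
  proof (rule ccontr)
    assume "\<gamma> \<notin> Z"
    then obtain N where "\<forall>r'. (\<forall>i<N. r' i = \<gamma> i) \<longrightarrow> r' \<in> - Z"
      using open_contains_agree[OF open_Compl[OF Z(1)], of \<gamma>] by auto
    then show False using Z(2)[of N] by (auto simp: mem_cyl)
  qed
  \<comment> \<open>An empty piece would be separable from everything. Nonempty pieces put the two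
    branches into the closed sets \<open>C\<close> and \<open>D\<close>.\<close>
  have ne: "cyl (s n) \<inter> C \<noteq> {}" "cyl (t n) \<inter> D \<noteq> {}" for n
    using st(3)[of n] sep_empty by auto
  have "\<alpha> \<in> C" by (rule limC[OF C(1)]) (unfold \<alpha>[symmetric], rule ne)
  moreover have "\<beta> \<in> D" by (rule limC[OF D(1)]) (unfold \<beta>[symmetric], rule ne)
  ultimately have "f \<alpha> \<noteq> h \<beta>" using assms(3) C(3) D(3) by blast
  then obtain U V where UV: "open U" "open V" "f \<alpha> \<in> U" "h \<beta> \<in> V" "U \<inter> V = {}"
    using hausdorff by metis
  have near: "\<exists>N. \<forall>n\<ge>N. k ` (cyl (map \<gamma> [0..<n]) \<inter> Z) \<subseteq> W"
    if k: "continuous_on Z k" "open W" "k \<gamma> \<in> W" "\<gamma> \<in> Z" for \<gamma> Z and k :: "(nat \<Rightarrow> nat) \<Rightarrow> 'a" and W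
  proof -
    obtain O' where O': "open O'" "O' \<inter> Z = k -` W \<inter> Z"
      using k(1,2) unfolding continuous_on_open_invariant by blast
    then have "\<gamma> \<in> O'" using k by blast
    then obtain N where "\<forall>r'. (\<forall>i<N. r' i = \<gamma> i) \<longrightarrow> r' \<in> O'"
      using open_contains_agree[OF O'(1)] by blast
    then have "\<forall>n\<ge>N. cyl (map \<gamma> [0..<n]) \<subseteq> O'" by (auto simp: mem_cyl)
    then show ?thesis using O'(2) by blast
  qed
  obtain N M where "\<forall>n\<ge>N. f ` (cyl (map \<alpha> [0..<n]) \<inter> C) \<subseteq> U"
    "\<forall>n\<ge>M. h ` (cyl (map \<beta> [0..<n]) \<inter> D) \<subseteq> V"
    using near[OF C(2) UV(1,3) \<open>\<alpha> \<in> C\<close>] near[OF D(2) UV(2,4) \<open>\<beta> \<in> D\<close>] by blast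
  then have "f ` (cyl (s (max N M)) \<inter> C) \<subseteq> U" "h ` (cyl (t (max N M)) \<inter> D) \<subseteq> V"
    by (auto simp: \<alpha> \<beta>)
  then have "sep (f ` (cyl (s (max N M)) \<inter> C)) (h ` (cyl (t (max N M)) \<inter> D))"
    unfolding sep_def using UV by (intro bexI[of _ U]) auto
  then show False using st(3) by blast
qed

section \<open>Two-colorable parts of an analytic digraph\<close>

lemma suslin_rtrancl_Image:
  fixes Q :: "('a::t2_space \<times> 'a) set"
  assumes "suslin Q" "suslin W"
  shows "suslin (Q\<^sup>* `` W)"
proof -
  have "suslin ((Q ^^ n) `` W)" for n
  proof (induction n)
    case (Suc n)
    have "(Q ^^ Suc n) `` W = Q `` ((Q ^^ n) `` W)" by (simp add: relcomp_Image)
    then show ?case using Suc suslin_Image[OF assms(1)] by simp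
  qed (simp add: assms)
  then have "suslin (\<Union>n. (Q ^^ n) `` W)" by (rule suslin_UN_nat)
  also have "(\<Union>n. (Q ^^ n) `` W) = Q\<^sup>* `` W" by (auto simp: rtrancl_is_UN_relpow)
  finally show ?thesis .
qed

lemma suslin_Domain: "suslin Q \<Longrightarrow> suslin (Domain Q)"
  unfolding fst_eq_Domain[symmetric]
  by (rule suslin_image) (auto intro!: continuous_on_fst continuous_on_id)

text \<open>A Borel set that separates \<open>A\<close> both from \<open>\<sigma> ` A\<close> and from the components that it reaches
  itself keeps its saturation disjoint from the mirror image. Alternating this with saturation
  gives a set that is Borel and saturated at once.\<close>

lemma borel_closed_hull:
  fixes Q :: "('a::t2_space \<times> 'a) set"
  assumes Q: "suslin Q" "sym Q"
    and \<sigma>: "continuous_on UNIV \<sigma>" "\<And>x. \<sigma> (\<sigma> x) = x" "\<And>x y. (x, y) \<in> Q \<Longrightarrow> (\<sigma> x, \<sigma> y) \<in> Q"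
    and W: "suslin W" "W \<subseteq> Domain Q" "\<And>a b. a \<in> W \<Longrightarrow> b \<in> W \<Longrightarrow> (a, \<sigma> b) \<notin> Q\<^sup>*"
  shows "\<exists>C\<in>sets borel. W \<subseteq> C \<and> Q `` C \<subseteq> C \<and> (\<forall>a\<in>C \<inter> Domain Q. \<sigma> a \<notin> C)"
proof -
  define P where "P = Domain Q"
  have sP: "suslin P" unfolding P_def by (rule suslin_Domain[OF Q(1)])
  have symR: "(x, y) \<in> Q\<^sup>* \<Longrightarrow> (y, x) \<in> Q\<^sup>*" for x y using Q(2) by (meson sym_rtrancl symD)
  have \<sigma>R: "(\<sigma> x, \<sigma> y) \<in> Q\<^sup>*" if "(x, y) \<in> Q\<^sup>*" for x y
    using that by induction (auto intro: \<sigma>(3) rtrancl_into_rtrancl)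
  have QP: "y \<in> P" if "(x, y) \<in> Q" for x y using that Q(2) unfolding P_def by (meson DomainI symD)
  have RP: "y \<in> P" if "(x, y) \<in> Q\<^sup>*" "x \<in> P" for x y
    using that(1) by cases (use that QP in auto)
  have \<sigma>P: "\<sigma> x \<in> P" if "x \<in> P" for x using that \<sigma>(3) unfolding P_def by blast
  have s\<sigma>: "suslin (\<sigma> ` S)" if "suslin S" for S
    using that by (rule suslin_image) (rule continuous_on_subset[OF \<sigma>(1)], simp)
  define good where "good A \<longleftrightarrow> suslin A \<and> A \<subseteq> P \<and> Q `` A \<subseteq> A \<and> A \<inter> \<sigma> ` A = {}" for A
  have closedR: "Q `` (Q\<^sup>* `` S) \<subseteq> Q\<^sup>* `` S" for S by (auto intro: rtrancl_into_rtrancl)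
  have goodI: "good (Q\<^sup>* `` S)" if "suslin S" "S \<subseteq> P"
    and *: "\<And>a b. a \<in> S \<Longrightarrow> b \<in> S \<Longrightarrow> (a, \<sigma> b) \<notin> Q\<^sup>*" for S
  proof -
    have False if "x \<in> S" "(x, a) \<in> Q\<^sup>*" "y \<in> S" "(y, b) \<in> Q\<^sup>*" "a = \<sigma> b" for x y a b
      using that * symR \<sigma>R by (metis rtrancl_trans)
    then show ?thesis unfolding good_def
      using that closedR suslin_rtrancl_Image[OF Q(1)] RP by blast
  qed
  have step: "\<exists>C\<in>sets borel. A \<subseteq> C \<and> good (Q\<^sup>* `` (C \<inter> P))" if "good A" for A
  proof -
    have A: "suslin A" "A \<subseteq> P" "Q `` A \<subseteq> A" "A \<inter> \<sigma> ` A = {}" using that by (auto simp: good_def)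
    obtain B where B: "B \<in> sets borel" "A \<subseteq> B" "B \<inter> \<sigma> ` A = {}"
      using borel_separation[OF A(1) s\<sigma>[OF A(1)] A(4)] by blast
    have sBP: "suslin (B \<inter> P)" using suslin_Int_borel[OF sP B(1)] by (simp add: Int_commute)
    have RA: "y \<in> A" if "x \<in> A" "(x, y) \<in> Q\<^sup>*" for x y
      using Image_closed_trancl[OF A(3)] that by blast
    have disj: "A \<inter> \<sigma> ` (Q\<^sup>* `` (B \<inter> P)) = {}"
    proof (rule ccontr)
      assume "\<not> ?thesis"
      then obtain b x where x: "\<sigma> x \<in> A" "b \<in> B" "(b, x) \<in> Q\<^sup>*" by blast
      then have "\<sigma> b \<in> A" using RA symR \<sigma>R by blast
      then have "b \<in> \<sigma> ` A" using \<sigma>(2) by (metis imageI)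
      then show False using B(3) x(2) by blast
    qed
    obtain B' where B': "B' \<in> sets borel" "A \<subseteq> B'" "B' \<inter> \<sigma> ` (Q\<^sup>* `` (B \<inter> P)) = {}"
      using borel_separation[OF A(1) s\<sigma>[OF suslin_rtrancl_Image[OF Q(1) sBP]] disj] by blast
    show ?thesis
    proof (intro bexI conjI)
      show "B \<inter> B' \<in> sets borel" using B(1) B'(1) by simp
      show "A \<subseteq> B \<inter> B'" using B(2) B'(2) by blast
      show "good (Q\<^sup>* `` (B \<inter> B' \<inter> P))"
      proof (rule goodI)
        show "suslin (B \<inter> B' \<inter> P)"
          using suslin_Int_borel[OF sBP B'(1)] by (simp add: Int_ac)
        show "B \<inter> B' \<inter> P \<subseteq> P" by blast
        fix a b assume ab: "a \<in> B \<inter> B' \<inter> P" "b \<in> B \<inter> B' \<inter> P"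
        show "(a, \<sigma> b) \<notin> Q\<^sup>*"
        proof
          assume "(a, \<sigma> b) \<in> Q\<^sup>*"
          then have "\<sigma> (\<sigma> b) \<in> \<sigma> ` (Q\<^sup>* `` (B \<inter> P))" using ab by blast
          then show False using B'(3) ab \<sigma>(2) by auto
        qed
      qed
    qed
  qed
  \<comment> \<open>\<open>fst (F n)\<close> is saturated and Suslin, \<open>snd (F n)\<close> is a
    Borel superset. Within \<open>P\<close> the latter lies in \<open>fst (F (Suc n))\<close>, so
    both sequences have the same union there; outside \<open>P\<close> there are no edges to
    respect.\<close>
  have "\<exists>F. \<forall>n. (good (fst (F n)) \<and> W \<subseteq> fst (F n) \<and> snd (F n) \<in> sets borel \<and> fst (F n) \<subseteq> snd (F n)
        \<and> good (Q\<^sup>* `` (snd (F n) \<inter> P))) \<and> fst (F (Suc n)) = Q\<^sup>* `` (snd (F n) \<inter> P)"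
  proof (rule dependent_nat_choice)
    have "good (Q\<^sup>* `` W)" by (rule goodI) (use W in \<open>auto simp: P_def\<close>)
    from step[OF this] obtain C where "C \<in> sets borel" "Q\<^sup>* `` W \<subseteq> C" "good (Q\<^sup>* `` (C \<inter> P))" by blast
    with \<open>good (Q\<^sup>* `` W)\<close> show "\<exists>x. good (fst x) \<and> W \<subseteq> fst x \<and> snd x \<in> sets borel \<and> fst x \<subseteq> snd x
        \<and> good (Q\<^sup>* `` (snd x \<inter> P))"
      by (intro exI[of _ "(Q\<^sup>* `` W, C)"]) auto
  next
    fix x :: "'a set \<times> 'a set" and n :: nat
    assume x: "good (fst x) \<and> W \<subseteq> fst x \<and> snd x \<in> sets borel \<and> fst x \<subseteq> snd x \<and> good (Q\<^sup>* `` (snd x \<inter> P))"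
    then have "good (Q\<^sup>* `` (snd x \<inter> P))" by blast
    from step[OF this] obtain C
      where C: "C \<in> sets borel" "Q\<^sup>* `` (snd x \<inter> P) \<subseteq> C" "good (Q\<^sup>* `` (C \<inter> P))"
      by blast
    have "W \<subseteq> Q\<^sup>* `` (snd x \<inter> P)" using x W(2) unfolding P_def by blast
    then show "\<exists>y. (good (fst y) \<and> W \<subseteq> fst y \<and> snd y \<in> sets borel \<and> fst y \<subseteq> snd y
        \<and> good (Q\<^sup>* `` (snd y \<inter> P))) \<and> fst y = Q\<^sup>* `` (snd x \<inter> P)"
      using x C by (intro exI[of _ "(Q\<^sup>* `` (snd x \<inter> P), C)"]) auto
  qed
  then obtain F where F: "\<And>n. good (fst (F n))" "\<And>n. W \<subseteq> fst (F n)" "\<And>n. snd (F n) \<in> sets borel"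
    "\<And>n. fst (F n) \<subseteq> snd (F n)" "\<And>n. fst (F (Suc n)) = Q\<^sup>* `` (snd (F n) \<inter> P)" by blast
  define A where "A n = fst (F n)" for n
  define C where "C n = snd (F n)" for n
  have A: "A n \<subseteq> P" "Q `` A n \<subseteq> A n" "A n \<inter> \<sigma> ` A n = {}" "A n \<subseteq> C n" for n
    using F(1)[of n] F(4) by (auto simp: good_def A_def C_def)
  have CA: "C n \<inter> P \<subseteq> A (Suc n)" for n using F(5)[of n] by (auto simp: A_def C_def)
  have mono: "A m \<subseteq> A n" if "m \<le> n" for m n
    by (rule lift_Suc_mono_le[OF _ that]) (use A(1,4) CA in blast)
  show ?thesis
  proof (intro bexI conjI ballI)
    show "(\<Union>n. C n) \<in> sets borel" using F(3) unfolding C_def by (intro sets.countable_UN) auto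
    show "W \<subseteq> (\<Union>n. C n)" using F(2,4) unfolding C_def by blast
    show "Q `` (\<Union>n. C n) \<subseteq> (\<Union>n. C n)"
    proof
      fix y assume "y \<in> Q `` (\<Union>n. C n)"
      then obtain n x where "x \<in> C n" "(x, y) \<in> Q" by blast
      then have "x \<in> A (Suc n)" using CA P_def by blast
      then have "y \<in> A (Suc n)" using A(2) \<open>(x, y) \<in> Q\<close> by blast
      then show "y \<in> (\<Union>n. C n)" using A(4) by blast
    qed
    fix a assume a: "a \<in> (\<Union>n. C n) \<inter> Domain Q"
    show "\<sigma> a \<notin> (\<Union>n. C n)"
    proof
      assume "\<sigma> a \<in> (\<Union>n. C n)"
      moreover have "\<sigma> a \<in> P" using a \<sigma>P P_def by blast
      ultimately obtain m where "\<sigma> a \<in> A m" using CA by blast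
      moreover obtain n where "a \<in> A n" using a CA P_def by blast
      ultimately have "\<sigma> a \<in> A (max m n)" "a \<in> A (max m n)" using mono by (meson max.cobounded1 max.cobounded2 subsetD)+
      then show False using A(3) by blast
    qed
  qed
qed

text \<open>Equivalences in place of implications make \<open>D \<union> E\<close> a union of
  components, so that colorings of disjoint sets of this kind fit together.\<close>

definition borel_bipartition :: "'a::topological_space digraph \<Rightarrow> 'a set \<Rightarrow> 'a set \<Rightarrow> bool" where
  "borel_bipartition G D E \<longleftrightarrow> D \<in> sets borel \<and> E \<in> sets borel \<and> D \<inter> E = {} \<and>
     (\<forall>x y. (x, y) \<in> G \<longrightarrow> (x \<in> D \<longleftrightarrow> y \<in> E) \<and> (x \<in> E \<longleftrightarrow> y \<in> D))"

definition small :: "'a::topological_space digraph \<Rightarrow> 'a set \<Rightarrow> bool" where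
  "small G S \<longleftrightarrow> (\<exists>D E. borel_bipartition G D E \<and> S \<subseteq> D \<union> E)"

lemma small_mono: "small G S \<Longrightarrow> T \<subseteq> S \<Longrightarrow> small G T"
  unfolding small_def by (meson order_trans)

lemma small_empty: "small G {}"
  unfolding small_def borel_bipartition_def by (intro exI[of _ "{}"]) auto

text \<open>Each point keeps its color from the first pair that covers it. This is consistent along
  edges because \<open>B n\<close>, the part covered before stage \<open>n\<close>, is
  invariant.\<close>

lemma small_UN_nat:
  assumes "\<And>n::nat. small G (S n)"
  shows "small G (\<Union>n. S n)"
proof -
  obtain D E where *: "\<And>n. borel_bipartition G (D n) (E n)" "\<And>n. S n \<subseteq> D n \<union> E n"
    using assms unfolding small_def by metis
  then have DE: "\<And>n. D n \<in> sets borel" "\<And>n. E n \<in> sets borel" "\<And>n. D n \<inter> E n = {}"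
    "\<And>n. S n \<subseteq> D n \<union> E n"
    "\<And>n x y. (x, y) \<in> G \<Longrightarrow> (x \<in> D n \<longleftrightarrow> y \<in> E n) \<and> (x \<in> E n \<longleftrightarrow> y \<in> D n)"
    unfolding borel_bipartition_def by blast+
  define B where "B n = (\<Union>m<n. D m \<union> E m)" for n
  have B: "B n \<in> sets borel" for n unfolding B_def using DE(1,2) by (intro sets.countable_UN') auto
  have inv: "x \<in> B n \<longleftrightarrow> y \<in> B n" if "(x, y) \<in> G" for x y n
    using DE(5)[OF that] unfolding B_def by blast
  have BD: "D m \<subseteq> B n" "E m \<subseteq> B n" if "m < n" for m n using that by (auto simp: B_def)
  have sub: "S n \<subseteq> (\<Union>n. D n - B n) \<union> (\<Union>n. E n - B n)" for n
  proof
    fix x assume "x \<in> S n"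
    then have ex: "x \<in> D n \<union> E n" using DE(4) by blast
    define m where "m = (LEAST m. x \<in> D m \<union> E m)"
    have "x \<in> D m \<union> E m" unfolding m_def by (rule LeastI[of "\<lambda>m. x \<in> D m \<union> E m", OF ex])
    moreover have "x \<notin> B m" unfolding B_def m_def using not_less_Least by blast
    ultimately show "x \<in> (\<Union>n. D n - B n) \<union> (\<Union>n. E n - B n)" by blast
  qed
  have "borel_bipartition G (\<Union>n. D n - B n) (\<Union>n. E n - B n)"
    unfolding borel_bipartition_def
  proof (intro conjI)
    show "(\<Union>n. D n - B n) \<in> sets borel" "(\<Union>n. E n - B n) \<in> sets borel"
      using DE(1,2) B by (intro sets.countable_UN; auto)+
    have False if "x \<in> D n - B n" "x \<in> E m - B m" for x m n
      using that BD[of m n] BD[of n m] DE(3)[of n] by (cases m n rule: linorder_cases) auto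
    then show "(\<Union>n. D n - B n) \<inter> (\<Union>n. E n - B n) = {}" by blast
    show "\<forall>x y. (x, y) \<in> G \<longrightarrow> (x \<in> (\<Union>n. D n - B n) \<longleftrightarrow> y \<in> (\<Union>n. E n - B n)) \<and>
        (x \<in> (\<Union>n. E n - B n) \<longleftrightarrow> y \<in> (\<Union>n. D n - B n))"
      using DE(5) inv by auto
  qed
  then show ?thesis using sub unfolding small_def by blast
qed

lemma small_UN:
  assumes "countable I" "\<And>i. i \<in> I \<Longrightarrow> small G (S i)"
  shows "small G (\<Union>i\<in>I. S i)"
proof (cases "I = {}")
  case False
  then have "\<And>n. small G (S (from_nat_into I n))"
    using assms(2) from_nat_into by metis
  then have "small G (\<Union>n. S (from_nat_into I n))"
    by (rule small_UN_nat)
  then have "small G (\<Union>i\<in>range (from_nat_into I). S i)"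
    by simp
  then show ?thesis
    using range_from_nat_into[OF False assms(1)] by (simp only:)
qed (simp add: small_empty)

lemma small_Un: "small G A \<Longrightarrow> small G B \<Longrightarrow> small G (A \<union> B)"
  using small_UN[of "{A, B}" G "\<lambda>S. S"] by (simp add: Un_commute) blast

section \<open>Signed walks\<close>

text \<open>Sign 1 follows an edge and sign -1 runs against it, the convention of
  \<open>L_path\<close>; the sign list of a walk can therefore become a value of
  \<open>d\<close>.\<close>

fun walk :: "'a digraph \<Rightarrow> 'a \<Rightarrow> int list \<Rightarrow> 'a \<Rightarrow> bool" where
  "walk G x [] y \<longleftrightarrow> x = y"
| "walk G x (e # l) y \<longleftrightarrow> e \<in> {-1, 1} \<and> (\<exists>w. pair_pow (x, w) e \<in> G \<and> walk G w l y)"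

lemma walk_append: "walk G x (l @ l') y \<longleftrightarrow> (\<exists>w. walk G x l w \<and> walk G w l' y)"
  by (induction l arbitrary: x) auto

lemma pair_pow_uminus: "e \<in> {-1, 1} \<Longrightarrow> pair_pow (x, w) (- e) = pair_pow (w, x) e"
  by (auto simp: pair_pow_def)

lemma walk_single: "walk G x [e] y \<longleftrightarrow> e \<in> {-1, 1} \<and> pair_pow (x, y) e \<in> G"
  by auto

lemma walk_rev: "walk G x l y \<Longrightarrow> walk G y (rev (map uminus l)) x"
proof (induction l arbitrary: x)
  case (Cons e l)
  then obtain w where "e \<in> {-1, 1}" "pair_pow (x, w) e \<in> G" "walk G w l y" by auto
  with Cons.IH[of w] show ?case
    by (auto simp: walk_append pair_pow_uminus)
qed simp

lemma sum_list_map_uminus: "sum_list (map uminus l) = - sum_list (l :: int list)"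
  by (induction l) auto

lemma walk_signs: "walk G x l y \<Longrightarrow> set l \<subseteq> {-1, 1}"
  by (induction l arbitrary: x) auto

lemma walk_parity: "walk G x l y \<Longrightarrow> odd (sum_list l) \<longleftrightarrow> odd (length l)"
  by (induction l arbitrary: x) auto

lemma walk_vertices:
  "walk G x l y \<Longrightarrow>
    \<exists>q. q 0 = x \<and> q (length l) = y \<and> (\<forall>i<length l. pair_pow (q i, q (Suc i)) (l ! i) \<in> G)"
proof (induction l arbitrary: x)
  case (Cons e l)
  then obtain w where w: "pair_pow (x, w) e \<in> G" "walk G w l y" by auto
  from Cons.IH[OF w(2)] obtain q where q: "q 0 = w" "q (length l) = y"
    "\<forall>i<length l. pair_pow (q i, q (Suc i)) (l ! i) \<in> G" by blast
  show ?case
    by (rule exI[of _ "case_nat x q"]) (use q w in \<open>auto simp: less_Suc_eq_0_disj\<close>)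
qed auto

section \<open>Smallness from restrictions on walks\<close>

lemma borel_bipartition_edge:
  "borel_bipartition G D E \<Longrightarrow> (x, y) \<in> G \<Longrightarrow> x \<in> D \<union> E \<longleftrightarrow> y \<in> D \<union> E"
  unfolding borel_bipartition_def by blast

lemma suslin_walk_Image:
  fixes G :: "'a::t2_space digraph"
  assumes "suslin G" "suslin S"
  shows "suslin {y. \<exists>x\<in>S. walk G x l y}"
  using assms(2)
proof (induction l arbitrary: S)
  case (Cons e l)
  define Q where "Q = (if e = 1 then G else prod.swap ` G)"
  have "suslin (prod.swap ` G)"
    by (rule suslin_image[OF assms(1)]) (rule continuous_on_swap)
  then have "suslin Q" using assms(1) by (simp add: Q_def)
  moreover have "(x, w) \<in> Q \<longleftrightarrow> pair_pow (x, w) e \<in> G" for x w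
    by (force simp: Q_def pair_pow_def)
  then have "{y. \<exists>x\<in>S. walk G x (e # l) y} =
      (if e \<in> {-1, 1} then {y. \<exists>w\<in>Q `` S. walk G w l y} else {})"
    by auto
  moreover have "suslin {y. \<exists>w\<in>Q `` S. walk G w l y}"
    by (rule Cons.IH[OF suslin_Image[OF \<open>suslin Q\<close> Cons.prems]])
  ultimately show ?case
    by (simp add: suslin_empty)
qed (simp add: Cons)

text \<open>There are only countably many sign lists, and reversing a walk turns its starting points
  into end points.\<close>

lemma suslin_walk_related:
  fixes G :: "'a::t2_space digraph"
  assumes "suslin G" "suslin S"
  shows "suslin {x\<in>S. \<exists>y\<in>S. \<exists>l. P l \<and> walk G x l y}"
proof -
  have "walk G x l y \<longleftrightarrow> walk G y (rev (map uminus l)) x" for x y l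
    using walk_rev[of G x l y] walk_rev[of G y "rev (map uminus l)" x]
    by (auto simp: rev_map[symmetric] o_def)
  then have "{x\<in>S. \<exists>y\<in>S. \<exists>l. P l \<and> walk G x l y} =
      S \<inter> (\<Union>l\<in>{l. P l}. {x. \<exists>y\<in>S. walk G y (rev (map uminus l)) x})"
    by auto
  also have "suslin \<dots>"
    by (intro suslin_Int suslin_UN assms suslin_walk_Image) auto
  finally show ?thesis .
qed

text \<open>\<open>Q\<close> is the bipartite double cover of \<open>G\<close> and
  \<open>\<sigma>\<close> exchanges its sheets; the parity of a walk decides whether its lift
  changes the sheet. The hypothesis thus keeps the copy of \<open>S\<close> on the sheet
  \<open>True\<close> apart from its mirror image, and the two slices of a Borel hull provide the
  color classes.\<close>

lemma small_if_no_odd_walk: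
  fixes G :: "'a::t2_space digraph"
  assumes G: "suslin G" and S: "suslin S" "S \<subseteq> Field G"
    and even: "\<And>x y l. x \<in> S \<Longrightarrow> y \<in> S \<Longrightarrow> walk G x l y \<Longrightarrow> even (length l)"
  shows "small G S"
proof -
  define Q :: "('a \<times> bool) digraph"
    where "Q = (\<Union>i. (\<lambda>p. ((fst p, i), (snd p, \<not> i))) ` G \<union> (\<lambda>p. ((snd p, i), (fst p, \<not> i))) ` G)"
  have Q_iff: "((x, i), (y, j)) \<in> Q \<longleftrightarrow> ((x, y) \<in> G \<or> (y, x) \<in> G) \<and> j = (\<not> i)" for x y i j
    unfolding Q_def UN_iff Un_iff image_iff Bex_def by auto
  have sQ: "suslin Q" unfolding Q_def
    by (intro suslin_UN suslin_Un suslin_image[OF G] continuous_on_Pair continuous_on_fst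
        continuous_on_snd continuous_on_id continuous_on_const) simp
  have sym: "sym Q" by (auto simp: sym_def Q_iff)
  define \<sigma> :: "'a \<times> bool \<Rightarrow> 'a \<times> bool" where "\<sigma> p = (fst p, \<not> snd p)" for p
  have "continuous_on UNIV (\<lambda>p::'a \<times> bool. \<not> snd p)"
    by (rule continuous_on_compose2[OF Topological_Spaces.continuous_on_discrete[of UNIV Not]
        continuous_on_snd[OF continuous_on_id]]) simp
  then have c\<sigma>: "continuous_on UNIV \<sigma>" unfolding \<sigma>_def
    by (intro continuous_on_Pair continuous_on_fst continuous_on_id)
  define W where "W = (\<lambda>x. (x, True)) ` S"
  have link: "\<exists>l. walk G (fst a) l (fst b) \<and> (even (length l) \<longleftrightarrow> snd a = snd b)" if "(a, b) \<in> Q\<^sup>*" for a b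
    using that
  proof induction
    case base then show ?case by (intro exI[of _ "[]"]) simp
  next
    case (step b c)
    then obtain l where l: "walk G (fst a) l (fst b)" "even (length l) \<longleftrightarrow> snd a = snd b" by blast
    have "((fst b, fst c) \<in> G \<or> (fst c, fst b) \<in> G)" "snd c \<longleftrightarrow> \<not> snd b"
      using step(2) Q_iff[of "fst b" "snd b" "fst c" "snd c"] by auto
    then obtain e where "walk G (fst b) [e] (fst c)"
      unfolding walk_single pair_pow_def by (metis insertI1 insertI2 prod.swap_def fst_conv snd_conv one_neq_neg_one)
    then have "walk G (fst a) (l @ [e]) (fst c)" unfolding walk_append using l(1) by blast
    moreover have "even (length (l @ [e])) \<longleftrightarrow> snd a = snd c" using l(2) \<open>snd c \<longleftrightarrow> \<not> snd b\<close> by auto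
    ultimately show ?case by blast
  qed
  have "\<exists>C\<in>sets borel. W \<subseteq> C \<and> Q `` C \<subseteq> C \<and> (\<forall>a\<in>C \<inter> Domain Q. \<sigma> a \<notin> C)"
  proof (rule borel_closed_hull[OF sQ sym c\<sigma>])
    show "suslin W" unfolding W_def
      by (intro suslin_image[OF S(1)] continuous_on_Pair continuous_on_id continuous_on_const)
    show "W \<subseteq> Domain Q" using S(2) by (auto simp: W_def Domain_iff Q_iff Field_def) blast+
    show "(a, \<sigma> b) \<notin> Q\<^sup>*" if "a \<in> W" "b \<in> W" for a b
      using link[of a "\<sigma> b"] even that by (fastforce simp: W_def \<sigma>_def)
  qed (auto simp: \<sigma>_def Q_iff)
  then obtain C where C: "C \<in> sets borel" "W \<subseteq> C" "Q `` C \<subseteq> C" "\<forall>a\<in>C \<inter> Domain Q. \<sigma> a \<notin> C" by blast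
  define H where "H i = {x. (x, i) \<in> C}" for i
  have "(\<lambda>x. (x, i)) \<in> borel_measurable (borel :: 'a measure)" for i :: bool
    by (intro borel_measurable_continuous_onI continuous_on_Pair continuous_on_id continuous_on_const)
  from measurable_sets[OF this C(1)] have H: "H i \<in> sets borel" for i
    by (simp add: H_def vimage_def)
  have step: "y \<in> H (\<not> i)" "y \<notin> H i" if "(x, y) \<in> G \<or> (y, x) \<in> G" "x \<in> H i" for x y i
  proof -
    have "((x, i), (y, \<not> i)) \<in> Q" using that by (simp add: Q_iff)
    then have yC: "(y, \<not> i) \<in> C" using C(3) that(2) unfolding H_def by blast
    then show "y \<in> H (\<not> i)" by (simp add: H_def)
    have "(y, \<not> i) \<in> Domain Q" using \<open>((x, i), (y, \<not> i)) \<in> Q\<close> sym by (meson DomainI symD)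
    then have "\<sigma> (y, \<not> i) \<notin> C" using C(4) yC by blast
    then show "y \<notin> H i" by (simp add: H_def \<sigma>_def)
  qed
  \<comment> \<open>Over points outside \<open>Field G\<close> the hull may contain both sheets, so
    \<open>H True\<close> is subtracted to make the classes disjoint. On \<open>Field G\<close> this
    removes nothing.\<close>
  have "borel_bipartition G (H True) (H False - H True)"
    unfolding borel_bipartition_def
  proof (intro conjI allI impI)
    fix x y assume xy: "(x, y) \<in> G"
    show "x \<in> H True \<longleftrightarrow> y \<in> H False - H True" "x \<in> H False - H True \<longleftrightarrow> y \<in> H True"
      using step[of x y True, simplified] step[of x y False, simplified]
        step[of y x True, simplified] step[of y x False, simplified] xy by blast+
  qed (use H in auto)
  moreover have "S \<subseteq> H True" using C(2) by (auto simp: W_def H_def)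
  ultimately show ?thesis unfolding small_def by blast
qed

lemma small_split:
  assumes "borel_bipartition G D E" "small G (S - (D \<union> E))"
  shows "small G S"
proof -
  have "small G (D \<union> E)" using assms(1) unfolding small_def by blast
  from small_Un[OF this assms(2)] show ?thesis by (rule small_mono) blast
qed

text \<open>With bound 0, reversal forces every sum to be 0, so all lengths are even. In the step,
  \<open>T\<close> collects the points of \<open>S\<close> from which the bound is attained. A walk
  between points of \<open>T\<close> can be continued by a walk of maximal sum, hence has sum at
  most 0; off an invariant Borel set around \<open>T\<close> the bound drops by one.\<close>

lemma small_if_walk_sums_bounded:
  fixes G :: "'a::t2_space digraph"
  assumes G: "suslin G" and "suslin S" "S \<subseteq> Field G"
    and "\<And>x y l. x \<in> S \<Longrightarrow> y \<in> S \<Longrightarrow> walk G x l y \<Longrightarrow> sum_list l \<le> int K"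
  shows "small G S"
  using assms(2-)
proof (induction K arbitrary: S)
  case 0
  show ?case
  proof (rule small_if_no_odd_walk[OF G 0(1,2)])
    fix x y l assume *: "x \<in> S" "y \<in> S" "walk G x l y"
    then have "sum_list l = 0"
      using 0(3)[OF *] 0(3)[OF *(2,1) walk_rev[OF *(3)]] by (simp add: sum_list_map_uminus)
    then show "even (length l)" using walk_parity[OF *(3)] by simp
  qed
next
  case (Suc K)
  define T where "T = {x\<in>S. \<exists>y\<in>S. \<exists>l. sum_list l = int (Suc K) \<and> walk G x l y}"
  have "small G T"
  proof (rule Suc.IH)
    show "suslin T" unfolding T_def by (rule suslin_walk_related[OF G Suc.prems(1)])
    show "T \<subseteq> Field G" using Suc.prems(2) by (auto simp: T_def)
    fix x x' l assume *: "x \<in> T" "x' \<in> T" "walk G x l x'"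
    then obtain y l' where y: "y \<in> S" "sum_list l' = int (Suc K)" "walk G x' l' y"
      unfolding T_def by blast
    have "walk G x (l @ l') y" using *(3) y(3) by (auto simp: walk_append)
    moreover have "x \<in> S" using *(1) by (simp add: T_def)
    ultimately have "sum_list (l @ l') \<le> int (Suc K)" using Suc.prems(3) y(1) by blast
    then show "sum_list l \<le> int K" using y(2) by simp
  qed
  then obtain D E where DE: "borel_bipartition G D E" "T \<subseteq> D \<union> E" unfolding small_def by blast
  show ?case
  proof (rule small_split[OF DE(1)], rule Suc.IH)
    show "suslin (S - (D \<union> E))"
      using DE(1) unfolding borel_bipartition_def by (intro suslin_Diff_borel[OF Suc.prems(1)]) auto
    show "S - (D \<union> E) \<subseteq> Field G" using Suc.prems(2) by blast
    fix x y l assume *: "x \<in> S - (D \<union> E)" "y \<in> S - (D \<union> E)" "walk G x l y"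
    then have "sum_list l \<le> int (Suc K)" using Suc.prems(3) by blast
    moreover have "sum_list l \<noteq> int (Suc K)" using * DE(2) unfolding T_def by blast
    ultimately show "sum_list l \<le> int K" by simp
  qed
qed

text \<open>If all odd walks between points of \<open>S\<close> have sum at most \<open>K\<close>, then the endpoints of odd walks
  have all their walks bounded by \<open>2K\<close>.\<close>

lemma odd_walk_if_not_small:
  fixes G :: "'a::t2_space digraph" and K :: int
  assumes G: "suslin G" and S: "suslin S" "S \<subseteq> Field G" and "\<not> small G S"
  shows "\<exists>x\<in>S. \<exists>y\<in>S. \<exists>l. walk G x l y \<and> odd (length l) \<and> 3 \<le> length l \<and> K < sum_list l"
proof (rule ccontr)
  assume "\<not> ?thesis"
  then have no: "sum_list l \<le> K"
    if "x \<in> S" "y \<in> S" "walk G x l y" "odd (length l)" "3 \<le> length l" for x y l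
    using that linorder_not_le by blast
  have bound: "sum_list l \<le> K" if xy: "x \<in> S" "y \<in> S" "walk G x l y" "odd (length l)" for x y l
  proof -
    obtain e l' where l: "l = e # l'" using xy(4) by (cases l) auto
    then obtain w where w: "e \<in> {-1, 1}" "pair_pow (x, w) e \<in> G" using xy(3) by auto
    then have "pair_pow (w, x) (- e) \<in> G" by (simp add: pair_pow_uminus)
    \<comment> \<open>Running along the first edge and back adds two steps of total sum 0, which
      meets the length condition.\<close>
    with w xy(3) have "walk G x (e # - e # l) y" by auto
    from no[OF xy(1,2) this] show ?thesis using xy(4) l by simp
  qed
  define T where "T = {x\<in>S. \<exists>y\<in>S. \<exists>l. odd (length l) \<and> walk G x l y}"
  have "small G T"
  proof (rule small_if_walk_sums_bounded[OF G, where K="nat (2 * \<bar>K\<bar>)"])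
    show "suslin T" unfolding T_def by (rule suslin_walk_related[OF G S(1)])
    show "T \<subseteq> Field G" using S(2) by (auto simp: T_def)
    fix x x' l assume *: "x \<in> T" "x' \<in> T" "walk G x l x'"
    then have xS: "x \<in> S" "x' \<in> S" by (auto simp: T_def)
    obtain y l' where y: "y \<in> S" "odd (length l')" "walk G x' l' y"
      using *(2) unfolding T_def by blast
    show "sum_list l \<le> int (nat (2 * \<bar>K\<bar>))"
    proof (cases "odd (length l)")
      case True
      then show ?thesis using bound[OF xS *(3)] by simp
    next
      case False
      have "walk G x (l @ l') y" using *(3) y(3) by (auto simp: walk_append)
      from bound[OF xS(1) y(1) this] have "sum_list l + sum_list l' \<le> K" using y(2) False by simp
      moreover have "- sum_list l' \<le> K"
        using bound[OF y(1) xS(2) walk_rev[OF y(3)]] y(2) by (simp add: sum_list_map_uminus)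
      ultimately show ?thesis by simp
    qed
  qed
  then obtain D E where DE: "borel_bipartition G D E" "T \<subseteq> D \<union> E" unfolding small_def by blast
  have "small G (S - (D \<union> E))"
  proof (rule small_if_no_odd_walk[OF G])
    show "suslin (S - (D \<union> E))"
      using DE(1) unfolding borel_bipartition_def by (intro suslin_Diff_borel[OF S(1)]) auto
    show "S - (D \<union> E) \<subseteq> Field G" using S(2) by blast
    show "even (length l)" if "x \<in> S - (D \<union> E)" "y \<in> S - (D \<union> E)" "walk G x l y" for x y l
      using that DE(2) unfolding T_def by blast
  qed
  then show False using small_split[OF DE(1)] assms(4) by blast
qed

section \<open>The graphs of an odd pair\<close>

lemma X_fin_nonempty: "v \<in> X_fin c n \<Longrightarrow> v \<noteq> []"
  by (auto simp: X_fin_def)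

lemma X_fin_0: "X_fin c 0 = {[k] | k. k \<le> c 0}"
  by (auto simp: X_fin_def)

lemma X_fin_Suc_cases:
  assumes "v \<in> X_fin c (Suc n)"
  obtains (copy) w j where "w \<in> X_fin c n" "j < 2" "v = w @ [j]"
    | (path) k where "k \<le> c (Suc n)" "v = [k]"
proof -
  obtain m k t where v: "v = k # t" "m \<le> Suc n" "k \<le> c m" "set t \<subseteq> {0, 1}" "length t = Suc n - m"
    using assms by (auto simp: X_fin_def)
  show thesis
  proof (cases t rule: rev_cases)
    case Nil
    then have "m = Suc n" using v by simp
    then show thesis using v Nil path[of k] by simp
  next
    case (snoc t' j)
    then have "k # t' \<in> X_fin c n" using v unfolding X_fin_def
      by (intro UN_I[of m]) (auto simp: Suc_diff_le)
    then show thesis using copy[of "k # t'" j] snoc v by auto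
  qed
qed

lemma X_fin_cong: "(\<And>i. i \<le> n \<Longrightarrow> c i = c' i) \<Longrightarrow> X_fin c n = X_fin c' n"
  unfolding X_fin_def by auto

lemma s_seq_cong: "c 0 = c' 0 \<Longrightarrow> s_seq c n = s_seq c' n"
  by (simp add: s_seq_def)

lemma L_fin_cong:
  "(\<And>i. i \<le> n \<Longrightarrow> c i = c' i \<and> d i = d' i) \<Longrightarrow> L_fin c d n = L_fin c' d' n"
proof (induction n)
  case (Suc n)
  then have "L_fin c d n = L_fin c' d' n" "c (Suc n) = c' (Suc n)" "d (Suc n) = d' (Suc n)"
    "s_seq c n = s_seq c' n"
    by (auto intro: s_seq_cong)
  then show ?case by simp
qed simp

lemma finite_X_fin: "finite (X_fin c n)"
proof (induction n)
  case (Suc n)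
  have "X_fin c (Suc n) \<subseteq> (\<lambda>(w, j). w @ [j]) ` (X_fin c n \<times> {..<2}) \<union> (\<lambda>k. [k]) ` {..c (Suc n)}"
    by (auto elim!: X_fin_Suc_cases)
  then show ?case by (rule finite_subset) (use Suc in auto)
qed (simp add: X_fin_0)

lemma L_path_const:
  assumes "\<And>v w. (v, w) \<in> L_path N e \<Longrightarrow> P v = P w" "k \<le> N"
  shows "P [k] = P [0]"
  using assms(2)
proof (induction k)
  case (Suc k)
  then have "pair_pow ([k], [k + 1]) (e ! (k + 1)) \<in> L_path N e" by (auto simp: L_path_def)
  then have "P [k] = P [k + 1]"
    using assms(1) by (auto simp: pair_pow_def split: if_splits)
  then show ?case using Suc by simp
qed simp

text \<open>Connectedness of the finite graph, phrased through functions that are constant along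
  edges: \<open>P\<close> may be membership in an invariant set or the comparison of the colors of
  two copies.\<close>

lemma L_fin_const:
  assumes "odd_pair c d" "\<And>v w. (v, w) \<in> L_fin c d n \<Longrightarrow> P v = P w" "v \<in> X_fin c n"
  shows "P v = P (s_seq c n)"
  using assms(2,3)
proof (induction n arbitrary: P v)
  case 0
  then obtain k where "v = [k]" "k \<le> c 0" by (auto simp: X_fin_0)
  have "P [i] = P [0]" if "i \<le> c 0" for i
    using 0(1) by (intro L_path_const[of "c 0" "d 0" P, OF _ that]) simp
  from this[OF \<open>k \<le> c 0\<close>] this[OF order_refl] show ?case by (simp only: \<open>v = [k]\<close> s_seq_def simp_thms if_True)
next
  case (Suc n)
  let ?e = "d (Suc n)" and ?N = "c (Suc n)" and ?s = "s_seq c n"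
  have onpath: "P [k] = P [0]" if "k \<le> ?N" for k
    using Suc.prems(1) by (intro L_path_const[of ?N ?e P, OF _ that]) auto
  have oncopy: "P (w @ [j]) = P (?s @ [j])" if "w \<in> X_fin c n" "j < 2" for w j
    using that Suc.prems(1) by (intro Suc.IH[of "\<lambda>w. P (w @ [j])"]) auto
  have "pair_pow (?s @ [0], [0]) (?e ! 0) \<in> L_fin c d (Suc n)"
    "pair_pow ([?N], ?s @ [1]) (?e ! (?N + 1)) \<in> L_fin c d (Suc n)" by simp_all
  then have "P (?s @ [0]) = P [0]" "P (?s @ [1]) = P [?N]"
    using Suc.prems(1) by (auto simp: pair_pow_def simp del: L_fin.simps split: if_splits)
  then have s: "P (?s @ [j]) = P [0]" if "j < 2" for j
    using that onpath[of ?N] by (auto simp: less_2_cases_iff)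
  have "P v = P [0]" if "v \<in> X_fin c (Suc n)" for v
    using that
  proof (cases rule: X_fin_Suc_cases)
    case (copy w j)
    then show ?thesis using oncopy s by metis
  next
    case (path k)
    then show ?thesis using onpath by metis
  qed
  then show ?case using Suc.prems(2) s_seq_in_X_fin[OF assms(1)] by metis
qed

text \<open>The two copies of a vertex are joined by a path of odd length.\<close>

lemma L_fin_two_coloring_flip:
  assumes b: "odd_pair c d" and f: "\<And>v w. (v, w) \<in> L_fin c d (Suc n) \<Longrightarrow> f v \<noteq> f w"
    and v: "v \<in> X_fin c n"
  shows "f (v @ [0]) \<noteq> (f (v @ [1]) :: bool)"
proof -
  let ?e = "d (Suc n)" and ?N = "c (Suc n)" and ?s = "s_seq c n"
  have path: "f [k] \<longleftrightarrow> (f [0] \<longleftrightarrow> even k)" if "k \<le> ?N" for k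
  proof -
    have "(f [k] \<longleftrightarrow> even (hd [k])) = (f [0] \<longleftrightarrow> even (hd [0::nat]))"
    proof (rule L_path_const[of ?N ?e "\<lambda>v. f v \<longleftrightarrow> even (hd v)", OF _ that])
      fix v w assume vw: "(v, w) \<in> L_path ?N ?e"
      then have "f v \<noteq> f w" using f by simp
      moreover have "even (hd v) \<noteq> even (hd w)"
        using vw by (auto simp: L_path_def pair_pow_def split: if_splits)
      ultimately show "(f v \<longleftrightarrow> even (hd v)) = (f w \<longleftrightarrow> even (hd w))" by blast
    qed
    then show ?thesis by auto
  qed
  have "odd ?N" using b by (simp add: odd_pair_def)
  then have "f [?N] \<noteq> f [0]" using path[of ?N] by blast
  moreover have "pair_pow (?s @ [0], [0]) (?e ! 0) \<in> L_fin c d (Suc n)"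
    "pair_pow ([?N], ?s @ [1]) (?e ! (?N + 1)) \<in> L_fin c d (Suc n)" by simp_all
  then have "f (?s @ [0]) \<noteq> f [0]" "f [?N] \<noteq> f (?s @ [1])"
    using f[of "?s @ [0]" "[0]"] f[of "[0]" "?s @ [0]"] f[of "[?N]" "?s @ [1]"] f[of "?s @ [1]" "[?N]"]
    by (auto simp: pair_pow_def simp del: L_fin.simps split: if_splits)
  \<comment> \<open>An edge changes the colors in both copies, so whether the copies of a vertex
    agree is constant along edges. By connectedness it suffices to consider
    \<open>?s\<close>.\<close>
  moreover have "(f (v @ [0]) = f (v @ [1])) = (f (?s @ [0]) = f (?s @ [1]))"
  proof (rule L_fin_const[OF b _ v, of "\<lambda>v. f (v @ [0]) = f (v @ [1])"])
    fix v w assume "(v, w) \<in> L_fin c d n"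
    then have "(v @ [0], w @ [0]) \<in> L_fin c d (Suc n)" "(v @ [1], w @ [1]) \<in> L_fin c d (Suc n)"
      by force+
    then have "f (v @ [0]) \<noteq> f (w @ [0])" "f (v @ [1]) \<noteq> f (w @ [1])"
      using f by blast+
    then show "(f (v @ [0]) = f (v @ [1])) = (f (w @ [0]) = f (w @ [1]))" by blast
  qed
  ultimately show ?thesis by blast
qed

section \<open>Edges of the limit graph\<close>

lemma L_fin_append:
  "(v, w) \<in> L_fin c d n \<Longrightarrow> set t \<subseteq> {0, 1} \<Longrightarrow> (v @ t, w @ t) \<in> L_fin c d (n + length t)"
proof (induction t rule: rev_induct)
  case (snoc j t)
  then have "j < 2" "(v @ t, w @ t) \<in> L_fin c d (n + length t)" by auto
  then have "((v @ t) @ [j], (w @ t) @ [j]) \<in> L_fin c d (Suc (n + length t))" by auto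
  then show ?case by simp
qed simp

text \<open>An edge that is not copied has an end born at level \<open>Suc n\<close>. The case
  \<open>path\<close> records only this, which is enough to tell it apart from a copy.\<close>

lemma L_fin_Suc_cases:
  assumes "(v, w) \<in> L_fin c d (Suc n)"
  obtains (copy) v' w' j where "j < 2" "(v', w') \<in> L_fin c d n" "v = v' @ [j]" "w = w' @ [j]"
    | (path) "length v = 1 \<or> length w = 1"
proof -
  from assms consider
    "\<exists>v' w' j. j < 2 \<and> (v', w') \<in> L_fin c d n \<and> v = v' @ [j] \<and> w = w' @ [j]"
    | "(v, w) \<in> L_path (c (Suc n)) (d (Suc n))"
    | "(v, w) = pair_pow (s_seq c n @ [0], [0]) (d (Suc n) ! 0)"
    | "(v, w) = pair_pow ([c (Suc n)], s_seq c n @ [1]) (d (Suc n) ! (c (Suc n) + 1))"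
    by auto
  then show thesis
  proof cases
    case 1 then show thesis using copy by blast
  next
    case 2 then have "length v = 1" by (auto simp: L_path_def pair_pow_def split: if_splits)
    then show thesis using path by blast
  next
    case 3 then have "length v = 1 \<or> length w = 1" by (auto simp: pair_pow_def split: if_splits)
    then show thesis by (rule path)
  next
    case 4 then have "length v = 1 \<or> length w = 1" by (auto simp: pair_pow_def split: if_splits)
    then show thesis by (rule path)
  qed
qed

text \<open>The point of the limit above the vertex \<open>v\<close> of level \<open>n\<close> whose
  remaining digits are \<open>z\<close>. A vertex loses no digit after its birth and gains one per
  level, whence the birth level \<open>Suc n - length v\<close>.\<close>

definition lift :: "nat \<Rightarrow> nat list \<Rightarrow> (nat \<Rightarrow> nat) \<Rightarrow> nat \<times> nat \<times> (nat \<Rightarrow> nat)" where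
  "lift n v z = (Suc n - length v, hd v, \<lambda>i. if i < length v - 1 then v ! Suc i else z (i - (length v - 1)))"

lemma fst_lift [simp]: "fst (lift n v z) = Suc n - length v"
  by (simp add: lift_def)

lemma lift_Cons:
  "lift n (k # t) z = (n - length t, k, \<lambda>i. if i < length t then t ! i else z (i - length t))"
  by (simp add: lift_def cong: if_cong)

lemma lift_snoc:
  assumes "v \<noteq> []"
  shows "lift (Suc n) (v @ [j]) z = lift n v (case_nat j z)"
proof -
  obtain k t where v: "v = k # t" using assms by (cases v) auto
  have "(if i < length (t @ [j]) then (t @ [j]) ! i else z (i - length (t @ [j]))) =
      (if i < length t then t ! i else case_nat j z (i - length t))" for i
    by (cases i "length t" rule: linorder_cases) (auto simp: nth_append diff_Suc split: nat.split)
  then show ?thesis by (simp add: v lift_Cons)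
qed

lemma proj_lift:
  assumes "v \<in> X_fin c n" "n \<le> N"
  shows "proj N (lift n v z) = v @ map z [0..<N - n]"
proof -
  obtain m k t where v: "v = k # t" "m \<le> n" "length t = n - m"
    using assms(1) by (auto simp: X_fin_def)
  have "map (\<lambda>i. if i < length t then t ! i else z (i - length t)) [0..<N - m] = t @ map z [0..<N - n]"
    using v assms(2) by (intro nth_equalityI) (auto simp: nth_append)
  then show ?thesis using v by (simp add: proj_def lift_Cons)
qed

lemma lift_in_X_lim:
  assumes "v \<in> X_fin c n" "\<And>i. z i < 2"
  shows "lift n v z \<in> X_lim c"
proof -
  obtain m k t where v: "v = k # t" "m \<le> n" "k \<le> c m" "set t \<subseteq> {0, 1}" "length t = n - m"
    using assms(1) by (auto simp: X_fin_def)
  have "t ! i < 2" if "i < length t" for i using nth_mem[OF that] v(4) by auto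
  then show ?thesis using v assms(2) by (auto simp: X_lim_def lift_Cons)
qed

text \<open>\<open>L_lim\<close> tests only levels from the later birth on. A copied edge is traced
  back, by moving its last digit into \<open>z\<close>, to the level where it was created. There one
  end is newly born, so only this level and later ones are tested, and they are covered by appending
  digits.\<close>

lemma lift_edge:
  assumes b: "odd_pair c d" and "(v, w) \<in> L_fin c d n" "\<And>i. z i < 2"
  shows "(lift n v z, lift n w z) \<in> L_lim c d"
  using assms(2,3)
proof (induction n arbitrary: v w z)
  have new: "(lift n v z, lift n w z) \<in> L_lim c d"
    if e: "(v, w) \<in> L_fin c d n" and z: "\<And>i. z i < 2" and l: "length v = 1 \<or> length w = 1" for v w z n
  proof -
    have vw: "v \<in> X_fin c n" "w \<in> X_fin c n" using L_fin_subset[OF b] e by auto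
    have "(proj N (lift n v z), proj N (lift n w z)) \<in> L_fin c d N"
      if "max (fst (lift n v z)) (fst (lift n w z)) \<le> N" for N
    proof -
      have N: "n \<le> N" using that l by auto
      have "set (map z [0..<N - n]) \<subseteq> {0, 1}" using z by (force simp: less_2_cases_iff)
      from L_fin_append[OF e this] show ?thesis
        using vw N by (simp add: proj_lift)
    qed
    then show ?thesis unfolding L_lim_def using vw z by (auto intro: lift_in_X_lim simp del: fst_lift)
  qed
  {
    case 0
    then have "length v = 1" by (auto simp: L_path_def pair_pow_def split: if_splits)
    then show ?case using 0 new by blast
  next
    case (Suc n)
    from Suc.prems(1) show ?case
    proof (cases rule: L_fin_Suc_cases)
      case (copy v' w' j)
      then have "v' \<noteq> []" "w' \<noteq> []" using L_fin_subset[OF b] X_fin_nonempty by blast+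
      moreover have "(lift n v' (case_nat j z), lift n w' (case_nat j z)) \<in> L_lim c d"
        using copy Suc.prems(2) by (intro Suc.IH) (auto split: nat.splits)
      ultimately show ?thesis using copy by (simp add: lift_snoc)
    next
      case path
      then show ?thesis using Suc.prems new by blast
    qed
  }
qed

section \<open>Obstructed Borel 2-colorings\<close>

text \<open>A cylinder is fixed by all but finitely many coordinate flips, so \<open>A\<close> and its complement have
  the same fair-coin measure on every cylinder and hence everywhere.\<close>

lemma no_borel_set_flipped_everywhere:
  fixes A :: "(nat \<Rightarrow> bool) set"
  assumes "A \<in> sets borel" and flip: "\<And>r p. r(p := \<not> r p) \<in> A \<longleftrightarrow> r \<notin> A"
  shows False
proof -
  define B where "B = (\<lambda>_::nat. measure_pmf (bernoulli_pmf (1/2)))"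
  define M where "M = Pi\<^sub>M UNIV B"
  interpret product_prob_space B UNIV
    unfolding B_def by unfold_locales
  have sB: "sets (B i) = UNIV" for i by (simp add: B_def)
  have spM: "space M = UNIV" by (simp add: M_def B_def space_PiM)
  have cyl: "prod_emb UNIV B J (Pi\<^sub>E J X) = {r. \<forall>j\<in>J. r j \<in> X j}" for J X
    by (auto simp: prod_emb_def B_def PiE_def Pi_def extensional_def restrict_def)
  \<comment> \<open>The cylinders \<open>I s\<close> are indexed by lists, so an open set is a
    countable union of them and Borel sets are measurable for the product measure.\<close>
  have "U \<in> sets M" if U: "open U" for U
  proof -
    define I where "I s = {r::nat \<Rightarrow> bool. \<forall>j\<in>{..<length s}. r j \<in> {s ! j}}" for s
    have "I s \<in> sets M" for s
      unfolding I_def M_def cyl[symmetric] by (intro sets_PiM_I) (auto simp: sB)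
    then have "(\<Union>s\<in>{s. I s \<subseteq> U}. I s) \<in> sets M" by (intro sets.countable_UN') auto
    also have "(\<Union>s\<in>{s. I s \<subseteq> U}. I s) = U"
    proof
      show "U \<subseteq> (\<Union>s\<in>{s. I s \<subseteq> U}. I s)"
      proof
        fix r assume "r \<in> U"
        then obtain N where N: "\<forall>r'. (\<forall>i<N. r' i = r i) \<longrightarrow> r' \<in> U"
          using open_contains_agree[OF U] by blast
        have "r \<in> I (map r [0..<N])" "I (map r [0..<N]) \<subseteq> U" using N by (auto simp: I_def)
        then show "r \<in> (\<Union>s\<in>{s. I s \<subseteq> U}. I s)" by blast
      qed
    qed auto
    finally show ?thesis .
  qed
  then have "sigma_sets (space M) {U. open U} \<subseteq> sets M" by (intro sets.sigma_sets_subset) auto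
  then have sM: "sets borel \<subseteq> sets M" by (simp add: borel_def spM)
  have A: "A \<in> sets M" "- A \<in> sets M" using assms(1) sM by auto
  define \<tau> where "\<tau> p r = r(p := \<not> r p)" for p and r :: "nat \<Rightarrow> bool"
  have m\<tau>: "\<tau> p \<in> measurable M M" for p
    unfolding M_def
  proof (rule measurable_PiM_single')
    fix i show "(\<lambda>r. \<tau> p r i) \<in> measurable (Pi\<^sub>M UNIV B) (B i)"
    proof (cases "i = p")
      case True
      have "(\<lambda>r. \<not> r p) \<in> measurable (Pi\<^sub>M UNIV B) (B i)"
        by (rule measurable_compose[OF measurable_component_singleton[of p]])
          (auto simp: B_def)
      then show ?thesis using True by (simp add: \<tau>_def)
    next
      case False
      have "(\<lambda>r. r i) \<in> measurable (Pi\<^sub>M UNIV B) (B i)"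
        by (rule measurable_component_singleton) simp
      then show ?thesis using False by (simp add: \<tau>_def)
    qed
  qed (simp add: B_def space_PiM)
  have fair: "emeasure (B i) (Not -` X) = emeasure (B i) X" for i X
  proof -
    have "Not -` {j} = {\<not> j}" for j by auto
    then have "map_pmf Not (bernoulli_pmf (1/2)) = bernoulli_pmf (1/2)"
      by (intro pmf_eqI) (simp add: pmf_map measure_pmf_single)
    then show ?thesis unfolding B_def by (metis emeasure_map_pmf)
  qed
  have inv: "distr M M (\<tau> p) = M" for p
    unfolding M_def
  proof (rule PiM_eq)
    show "sets (distr (Pi\<^sub>M UNIV B) (Pi\<^sub>M UNIV B) (\<tau> p)) = sets (Pi\<^sub>M UNIV B)" by simp
    fix J F assume J: "finite J" and F: "\<And>j. j \<in> J \<Longrightarrow> F j \<in> sets (B j)"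
    define H where "H j = (if j = p then Not -` F j else F j)" for j
    have "\<tau> p -` prod_emb UNIV B J (Pi\<^sub>E J F) = prod_emb UNIV B J (Pi\<^sub>E J H)"
      unfolding cyl by (auto simp: \<tau>_def H_def split: if_splits)
    moreover have "prod_emb UNIV B J (Pi\<^sub>E J F) \<in> sets (Pi\<^sub>M UNIV B)"
      using J F by (intro sets_PiM_I) auto
    ultimately have "emeasure (distr (Pi\<^sub>M UNIV B) (Pi\<^sub>M UNIV B) (\<tau> p)) (prod_emb UNIV B J (Pi\<^sub>E J F))
        = emeasure (Pi\<^sub>M UNIV B) (prod_emb UNIV B J (Pi\<^sub>E J H))"
      using m\<tau>[of p] spM by (simp add: emeasure_distr M_def)
    also have "\<dots> = (\<Prod>j\<in>J. emeasure (B j) (H j))"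
      using J by (intro emeasure_PiM_emb) (auto simp: sB)
    also have "\<dots> = (\<Prod>j\<in>J. emeasure (B j) (F j))"
      by (rule prod.cong) (auto simp: H_def fair)
    finally show "emeasure (distr (Pi\<^sub>M UNIV B) (Pi\<^sub>M UNIV B) (\<tau> p)) (prod_emb UNIV B J (Pi\<^sub>E J F))
        = (\<Prod>j\<in>J. emeasure (B j) (F j))" .
  qed
  have half: "emeasure M (A \<inter> Z) = emeasure M (- A \<inter> Z)"
    if Z: "Z = prod_emb UNIV B J (Pi\<^sub>E J X)" "finite J" for Z J X
  proof -
    obtain p where p: "p \<notin> J" using Z(2) ex_new_if_finite[OF infinite_UNIV_nat] by blast
    have sZ: "Z \<in> sets M" unfolding Z M_def using Z(2) by (intro sets_PiM_I) (auto simp: sB)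
    have "\<tau> p -` (A \<inter> Z) = - A \<inter> Z"
      using p flip unfolding Z cyl \<tau>_def by auto
    moreover have "emeasure (distr M M (\<tau> p)) (A \<inter> Z) = emeasure M (\<tau> p -` (A \<inter> Z) \<inter> space M)"
      by (rule emeasure_distr[OF m\<tau>]) (use A sZ in auto)
    ultimately show ?thesis by (simp add: inv spM)
  qed
  define N where "N S = density M (indicator S)" for S :: "(nat \<Rightarrow> bool) set"
  have N: "emeasure (N S) Z = emeasure M (S \<inter> Z)" if "S \<in> sets M" "Z \<in> sets M" for S Z
    unfolding N_def using that
    by (subst emeasure_density) (auto simp: nn_integral_indicator indicator_inter_arith[symmetric])
  have "N A = N (- A)"
  proof (rule measure_eqI_PiM_infinite[where I = UNIV and M = B])
    show "sets (N A) = sets (Pi\<^sub>M UNIV B)" "sets (N (- A)) = sets (Pi\<^sub>M UNIV B)"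
      by (simp_all add: N_def M_def)
    show "finite_measure (N A)"
    proof (rule finite_measureI)
      have "emeasure (N A) (space (N A)) = emeasure M (A \<inter> space M)"
        using N[OF A(1) sets.top] by (simp add: N_def)
      then show "emeasure (N A) (space (N A)) \<noteq> \<infinity>"
        using P.emeasure_finite unfolding M_def by simp
    qed
    fix X J assume J: "finite (J :: nat set)"
    have "prod_emb UNIV B J (Pi\<^sub>E J X) \<in> sets M"
      unfolding M_def using J by (intro sets_PiM_I) (auto simp: sB)
    then show "emeasure (N A) (prod_emb UNIV B J (Pi\<^sub>E J X)) = emeasure (N (- A)) (prod_emb UNIV B J (Pi\<^sub>E J X))"
      using half[OF refl J] A by (simp add: N)
  qed
  \<comment> \<open>Testing the equality of the two measures on \<open>A\<close> and on
    \<open>- A\<close> makes both sets null.\<close>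
  then have "emeasure M (A \<inter> A) = emeasure M (- A \<inter> A)" "emeasure M (A \<inter> - A) = emeasure M (- A \<inter> - A)"
    using N A by metis+
  then have "emeasure M A = 0" "emeasure M (- A) = 0" by simp_all
  then have "emeasure M (A \<union> - A) = 0"
    using A by (intro emeasure_Un_null_set[THEN trans]) (auto simp: null_sets_def)
  then show False using P.emeasure_space_1 spM unfolding M_def by simp
qed

lemma continuous_of_bool_sequence:
  "continuous_on UNIV (\<lambda>r::nat \<Rightarrow> bool. (0::nat, 0::nat, \<lambda>i. of_bool (r i) :: nat))"
  by (intro continuous_on_Pair continuous_on_const continuous_on_coordinatewise_then_product
      continuous_on_compose2[OF Topological_Spaces.continuous_on_discrete[of UNIV of_bool]
        continuous_on_product_coordinates]) simp

text \<open>\<open>\<iota>\<close> embeds the Cantor space as the points above the vertex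
  \<open>[0]\<close> of level 0. Two sequences that differ at \<open>p\<close> only are the two
  copies, at level \<open>Suc p\<close>, of one vertex of level \<open>p\<close>, continued by the
  same digits \<open>z\<close>; hence exactly one of them is sent into \<open>A\<close>.\<close>

lemma L_lim_no_borel_bipartition:
  fixes A :: "'a::topological_space set"
  assumes b: "odd_pair c d" and \<phi>: "continuous_on (X_lim c) \<phi>" and A: "A \<in> sets borel"
    and split: "\<And>x y. (x, y) \<in> L_lim c d \<Longrightarrow> \<phi> x \<in> A \<longleftrightarrow> \<phi> y \<notin> A"
  shows False
proof -
  define \<iota> where "\<iota> r = (0::nat, 0::nat, \<lambda>i. of_bool (r i) :: nat)" for r :: "nat \<Rightarrow> bool"
  have "continuous_on UNIV \<iota>" unfolding \<iota>_def by (rule continuous_of_bool_sequence)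
  moreover have "\<iota> r \<in> X_lim c" for r by (simp add: \<iota>_def X_lim_def)
  ultimately have "continuous_on UNIV (\<lambda>r. \<phi> (\<iota> r))"
    by (intro continuous_on_compose2[OF \<phi>]) auto
  then have "(\<lambda>r. \<phi> (\<iota> r)) \<in> borel_measurable borel" by (rule borel_measurable_continuous_onI)
  from measurable_sets[OF this A] have "{r. \<phi> (\<iota> r) \<in> A} \<in> sets borel" by (simp add: vimage_def)
  moreover have "r(p := \<not> r p) \<in> {r. \<phi> (\<iota> r) \<in> A} \<longleftrightarrow> r \<notin> {r. \<phi> (\<iota> r) \<in> A}" for r p
  proof -
    define z where "z i = (of_bool (r (i + Suc p)) :: nat)" for i
    define v where "v = 0 # map (\<lambda>i. of_bool (r i) :: nat) [0..<p]"
    define f where "f w \<longleftrightarrow> \<phi> (lift (Suc p) w z) \<in> A" for w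
    have v: "v \<in> X_fin c p" unfolding X_fin_def v_def
      by (rule UN_I[of 0]) auto
    have L: "lift (Suc p) (v @ [of_bool j]) z = \<iota> (r(p := j))" for j
    proof -
      have "(\<lambda>i. if i < length (map (\<lambda>i. of_bool (r i)) [0..<p] @ [of_bool j])
          then (map (\<lambda>i. of_bool (r i)) [0..<p] @ [of_bool j]) ! i
          else z (i - length (map (\<lambda>i. of_bool (r i)) [0..<p] @ [of_bool j]))) = (\<lambda>i. of_bool ((r(p := j)) i) :: nat)" (is "?l = ?r")
      proof
        fix i show "?l i = ?r i" by (cases i p rule: linorder_cases) (auto simp: nth_append z_def)
      qed
      then show ?thesis unfolding v_def append_Cons lift_Cons \<iota>_def prod.inject
        by (intro conjI, simp, intro refl, assumption)
    qed
    have "f (v @ [0]) \<noteq> f (v @ [1])"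
    proof (rule L_fin_two_coloring_flip[OF b _ v])
      fix v w assume "(v, w) \<in> L_fin c d (Suc p)"
      then have "(lift (Suc p) v z, lift (Suc p) w z) \<in> L_lim c d"
        by (rule lift_edge[OF b]) (simp add: z_def)
      then show "f v \<noteq> f w" using split unfolding f_def by blast
    qed
    then have "\<phi> (\<iota> (r(p := False))) \<in> A \<longleftrightarrow> \<phi> (\<iota> (r(p := True))) \<notin> A"
      using L[of False] L[of True] unfolding f_def by simp
    then show ?thesis by (cases "r p") (auto simp: fun_upd_idem)
  qed
  ultimately show False by (rule no_borel_set_flipped_everywhere)
qed

section \<open>Borel chromatic number at most two\<close>

text \<open>A finite metrizable space is discrete. This makes single color classes Borel when there
  are finitely many colors.\<close>

lemma standard_borel_singleton:
  assumes "standard_borel M" "finite (space M)" "a \<in> space M"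
  shows "{a} \<in> sets M"
proof -
  obtain T where T: "topspace T = space M" "completely_metrizable_space T"
    "sets M = sigma_sets (topspace T) {U. openin T U}"
    using assms(1) unfolding standard_borel_def by blast
  have "t1_space T"
    using T(2) completely_metrizable_imp_metrizable_space metrizable_imp_Hausdorff_space
      Hausdorff_imp_t1_space by blast
  moreover have "finite (topspace T)" using T(1) assms(2) by simp
  ultimately have "openin T {a}" using T(1) assms(3)
    by (metis discrete_topology_unique finite_t1_space_imp_discrete_topology openin_discrete_topology
        empty_subsetI insert_subset)
  then show ?thesis unfolding T(3) by (intro sigma_sets.Basic) simp
qed

lemma borel_colorable_card_two:
  fixes G :: "'a::topological_space digraph" and a b :: real
  assumes A: "A \<in> sets borel" "\<And>x y. (x, y) \<in> G \<Longrightarrow> x \<in> A \<longleftrightarrow> y \<notin> A" and "a \<noteq> b"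
  shows "borel_colorable G (card_of {a, b})"
  unfolding borel_colorable_def
proof (intro exI conjI)
  let ?M = "count_space {a, b}" and ?col = "\<lambda>x. if x \<in> A then a else b"
  show "space ?M = Field (card_of {a, b})" by (simp add: Field_card_of)
  show "standard_borel ?M" unfolding standard_borel_def
  proof (intro exI conjI)
    let ?T = "discrete_topology {a, b}"
    show "topspace ?T = space ?M" by simp
    show "completely_metrizable_space ?T" by (rule completely_metrizable_space_discrete_topology)
    show "separable_space ?T" by (simp add: separable_space_discrete_topology)
    show "sets ?M = sigma_sets (topspace ?T) {U. openin ?T U}"
    proof
      show "sets ?M \<subseteq> sigma_sets (topspace ?T) {U. openin ?T U}"
        by (auto intro: sigma_sets.Basic)
      show "sigma_sets (topspace ?T) {U. openin ?T U} \<subseteq> sets ?M"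
        using sigma_sets_into_sp[of "{U. openin ?T U}" "{a, b}"] by auto
    qed
  qed
  have "?col \<in> measurable borel ?M"
    using A(1) by (intro measurable_If_set) auto
  then show "borel_coloring G ?M ?col"
    using A(2) assms(3) unfolding borel_coloring_def by auto
qed

text \<open>An edge forces two colors on every coloring, so a two-point cardinal that admits a Borel
  coloring is the least one and the chromatic number exists.\<close>

lemma borel_chromatic_number_le_2_iff:
  fixes G :: "'a::topological_space digraph"
  assumes "G \<noteq> {}"
  shows "borel_chromatic_number_le G 2 \<longleftrightarrow>
    (\<exists>A\<in>sets borel. \<forall>(x, y)\<in>G. x \<in> A \<longleftrightarrow> y \<notin> A)"
proof
  assume "borel_chromatic_number_le G 2"
  then obtain \<kappa> where \<kappa>: "borel_colorable G \<kappa>" "(\<kappa>, natLeq_on 2) \<in> ordLeq"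
    unfolding borel_chromatic_number_le_def is_borel_chromatic_number_def by blast
  then obtain M col where M: "space M = Field \<kappa>" "standard_borel M" "col \<in> measurable borel M"
    "\<And>x y. (x, y) \<in> G \<Longrightarrow> col x \<noteq> col y"
    unfolding borel_colorable_def borel_coloring_def by blast
  have "(card_of (Field \<kappa>), card_of (Field (natLeq_on 2))) \<in> ordLeq" using card_of_mono2[OF \<kappa>(2)] .
  then have "(card_of (Field \<kappa>), card_of {x. x < (2::nat)}) \<in> ordLeq" by (simp only: Field_natLeq_on)
  then obtain g where g: "inj_on g (Field \<kappa>)" "g ` Field \<kappa> \<subseteq> {..<2::nat}"
    unfolding card_of_ordLeq[symmetric] by (auto simp: lessThan_def)
  have fin: "finite (Field \<kappa>)" using g by (meson finite_imageD finite_lessThan finite_subset)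
  have card: "card (Field \<kappa>) \<le> 2" using card_inj_on_le[OF g] by simp
  have col: "col x \<in> Field \<kappa>" for x using measurable_space[OF M(3), of x] M(1) by simp
  \<comment> \<open>Any point will do: with at most two colors, exactly one end of every edge has
    the color of \<open>x0\<close>.\<close>
  obtain x0 :: 'a where True by simp
  define A where "A = col -` {col x0}"
  have "{col x0} \<in> sets M" by (rule standard_borel_singleton) (use M fin col in auto)
  from measurable_sets[OF M(3) this] have "A \<in> sets borel" by (simp add: A_def)
  moreover have "x \<in> A \<longleftrightarrow> y \<notin> A" if "(x, y) \<in> G" for x y
  proof -
    have ne: "col x \<noteq> col y" using M(4) that .
    have "col x0 = col x \<or> col x0 = col y"
    proof (rule ccontr)
      assume "\<not> ?thesis"
      then have "card {col x0, col x, col y} = 3" using ne by auto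
      moreover have "card {col x0, col x, col y} \<le> card (Field \<kappa>)" using col by (intro card_mono fin) auto
      ultimately show False using card by simp
    qed
    then show ?thesis using ne unfolding A_def by (metis vimage_singleton_eq)
  qed
  ultimately show "\<exists>A\<in>sets borel. \<forall>(x, y)\<in>G. x \<in> A \<longleftrightarrow> y \<notin> A"
    by (intro bexI[of _ A]) auto
next
  assume "\<exists>A\<in>sets borel. \<forall>(x, y)\<in>G. x \<in> A \<longleftrightarrow> y \<notin> A"
  then obtain A where A: "A \<in> sets borel" "\<And>x y. (x, y) \<in> G \<Longrightarrow> x \<in> A \<longleftrightarrow> y \<notin> A" by blast
  let ?\<kappa> = "card_of {0, 1::real}"
  have min: "(?\<kappa>, \<mu>) \<in> ordLeq" if \<mu>: "Card_order \<mu>" "borel_colorable G \<mu>" for \<mu> :: "real rel"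
  proof -
    obtain M and col :: "'a \<Rightarrow> real" where M: "space M = Field \<mu>" "col \<in> measurable borel M"
      "\<And>x y. (x, y) \<in> G \<Longrightarrow> col x \<noteq> col y"
      using \<mu>(2) unfolding borel_colorable_def borel_coloring_def by blast
    obtain x y where xy: "(x, y) \<in> G" using assms by auto
    have col: "col x \<in> Field \<mu>" for x using measurable_space[OF M(2), of x] M(1) by simp
    have "inj_on (\<lambda>t::real. if t = 0 then col x else col y) {0, 1}" using M(3)[OF xy] by (auto simp: inj_on_def)
    moreover have "(\<lambda>t::real. if t = 0 then col x else col y) ` {0, 1} \<subseteq> Field \<mu>" using col by auto
    ultimately have "(?\<kappa>, card_of (Field \<mu>)) \<in> ordLeq" unfolding card_of_ordLeq[symmetric] by blast
    then show ?thesis using card_of_Field_ordIso[OF \<mu>(1)] by (rule ordLeq_ordIso_trans)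
  qed
  have "inj_on (\<lambda>t::real. if t = 0 then 0 else 1 :: nat) {0, 1}"
    "(\<lambda>t::real. if t = 0 then 0 else 1 :: nat) ` {0, 1} \<subseteq> {x. x < 2}" by (auto simp: inj_on_def)
  then have "(?\<kappa>, card_of {x. x < (2::nat)}) \<in> ordLeq" unfolding card_of_ordLeq[symmetric] by blast
  then have "(?\<kappa>, natLeq_on 2) \<in> ordLeq"
    using card_of_least[OF natLeq_on_well_order_on] by (rule ordLeq_transitive)
  moreover have "is_borel_chromatic_number G ?\<kappa>"
    unfolding is_borel_chromatic_number_def
    using min borel_colorable_card_two[OF A(1), where a = 0 and b = 1] A(2) by (simp add: card_of_Card_order)
  ultimately show "borel_chromatic_number_le G 2" unfolding borel_chromatic_number_le_def by blast
qed

section \<open>Approximations of a homomorphism\<close>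

text \<open>Passage to the limit without a metric: if the two values differed, disjoint
  neighborhoods would contain the values at all codes agreeing far enough with
  \<open>\<alpha>\<close> and \<open>\<beta>\<close>, yet some such codes have equal values.\<close>

lemma limit_point_eqI:
  fixes F F' :: "(nat \<Rightarrow> nat) \<Rightarrow> 'a::t2_space"
  assumes F: "continuous_on UNIV F" "continuous_on UNIV F'"
    and near: "\<And>N. \<exists>n\<ge>N. \<exists>\<alpha>' \<beta>'. map \<alpha>' [0..<n] = map \<alpha> [0..<n] \<and>
      map \<beta>' [0..<n] = map \<beta> [0..<n] \<and> F \<alpha>' = F' \<beta>'"
  shows "F \<alpha> = F' \<beta>"
proof (rule ccontr)
  assume "F \<alpha> \<noteq> F' \<beta>"
  then obtain U V where UV: "open U" "open V" "F \<alpha> \<in> U" "F' \<beta> \<in> V" "U \<inter> V = {}"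
    using hausdorff by metis
  have "open (F -` U)" "open (F' -` V)" using UV F by (auto intro: open_vimage)
  then obtain M N where MN: "\<forall>\<alpha>'. (\<forall>i<M. \<alpha>' i = \<alpha> i) \<longrightarrow> \<alpha>' \<in> F -` U"
    "\<forall>\<beta>'. (\<forall>i<N. \<beta>' i = \<beta> i) \<longrightarrow> \<beta>' \<in> F' -` V"
    using open_contains_agree[of "F -` U" \<alpha>] open_contains_agree[of "F' -` V" \<beta>] UV by auto
  obtain n \<alpha>' \<beta>' where n: "n \<ge> max M N" "map \<alpha>' [0..<n] = map \<alpha> [0..<n]"
    "map \<beta>' [0..<n] = map \<beta> [0..<n]" "F \<alpha>' = F' \<beta>'" using near by blast
  have "\<forall>i<M. \<alpha>' i = \<alpha> i" "\<forall>i<N. \<beta>' i = \<beta> i" using n(1-3) by auto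
  then have "F \<alpha>' \<in> U" "F' \<beta>' \<in> V" using MN by blast+
  then show False using n(4) UV(5) by auto
qed

text \<open>An edge \<open>(v, w)\<close> of a finite graph and, as \<open>(v, v)\<close>, each vertex.\<close>

definition cells :: "(nat \<Rightarrow> nat) \<Rightarrow> (nat \<Rightarrow> int list) \<Rightarrow> nat \<Rightarrow> (nat list \<times> nat list) set" where
  "cells c d n = (\<lambda>v. (v, v)) ` X_fin c n \<union> L_fin c d n"

lemma cells_cong:
  "(\<And>i. i \<le> n \<Longrightarrow> c i = c' i \<and> d i = d' i) \<Longrightarrow> cells c d n = cells c' d' n"
  unfolding cells_def using X_fin_cong[of n c c'] L_fin_cong[of n c c' d d'] by auto

lemma finite_cells: "odd_pair c d \<Longrightarrow> finite (cells c d n)"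
  unfolding cells_def
  by (intro finite_UnI finite_imageI finite_X_fin
      finite_subset[OF L_fin_subset finite_cartesian_product[OF finite_X_fin finite_X_fin]])

lemma cells_subset: "odd_pair c d \<Longrightarrow> cells c d n \<subseteq> X_fin c n \<times> X_fin c n"
  unfolding cells_def using L_fin_subset by blast

lemma cells_snoc: "(v, w) \<in> cells c d n \<Longrightarrow> j < 2 \<Longrightarrow> (v @ [j], w @ [j]) \<in> cells c d (Suc n)"
  unfolding cells_def by (auto intro: snoc_in_X_fin)

lemma proj_in_X_fin: "x \<in> X_lim c \<Longrightarrow> fst x \<le> n \<Longrightarrow> proj n x \<in> X_fin c n"
  unfolding X_lim_def X_fin_def proj_def by (force simp: less_2_cases_iff)

lemma proj_Suc:
  assumes "x \<in> X_lim c" "fst x \<le> n"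
  obtains j where "j < 2" "proj (Suc n) x = proj n x @ [j]"
proof -
  obtain m k r where x: "x = (m, k, r)" by (cases x)
  then have "proj (Suc n) x = proj n x @ [r (n - m)]" "r (n - m) < 2"
    using assms by (auto simp: proj_def X_lim_def Suc_diff_le)
  then show thesis using that by blast
qed

text \<open>A noncopied edge has an end of length 1, whereas points born by level \<open>n\<close>
  have longer projections at level \<open>Suc n\<close>. So from the later birth on, a cell of the
  limit passes from one level to the next by copying.\<close>

lemma cells_proj_Suc:
  assumes "x \<in> X_lim c" "y \<in> X_lim c" "fst x \<le> n" "fst y \<le> n"
    and cell: "(proj (Suc n) x, proj (Suc n) y) \<in> cells c d (Suc n)"
  obtains j where "j < 2" "proj (Suc n) x = proj n x @ [j]" "proj (Suc n) y = proj n y @ [j]"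
proof -
  obtain i where i: "i < 2" "proj (Suc n) x = proj n x @ [i]" using proj_Suc[OF assms(1,3)] .
  obtain j where j: "j < 2" "proj (Suc n) y = proj n y @ [j]" using proj_Suc[OF assms(2,4)] .
  have ne: "proj n x \<noteq> []" "proj n y \<noteq> []" by (auto simp: proj_def split: prod.splits)
  have "i = j"
  proof (cases "proj (Suc n) x = proj (Suc n) y")
    case False
    then have "(proj (Suc n) x, proj (Suc n) y) \<in> L_fin c d (Suc n)"
      using cell by (auto simp: cells_def)
    then show ?thesis by (cases rule: L_fin_Suc_cases) (use i j ne in auto)
  qed (use i j in simp)
  then show thesis using that i j by blast
qed

section \<open>Codes and finite approximations\<close>

locale coded_digraph =
  fixes G :: "'a::t2_space digraph" and g :: "(nat \<Rightarrow> nat) \<Rightarrow> 'a \<times> 'a"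
  assumes g_cont: "continuous_on UNIV g" and g_range: "range g = G" and irr: "irrefl G"
begin

lemma suslin_G: "suslin G"
  by (rule suslin_analytic) (use g_cont g_range in \<open>auto simp: analytic_set_def\<close>)

text \<open>A vertex is coded by an edge on which it lies, with the first entry choosing the end.
  This is a continuous parametrization of \<open>Field G\<close> by Baire space.\<close>

definition p :: "(nat \<Rightarrow> nat) \<Rightarrow> 'a" where
  "p \<alpha> = (if \<alpha> 0 = 0 then fst (g (\<lambda>i. \<alpha> (Suc i))) else snd (g (\<lambda>i. \<alpha> (Suc i))))"

lemma p_cont: "continuous_on UNIV p"
proof -
  have g': "continuous_on S (\<lambda>\<alpha>. g (\<lambda>i. \<alpha> (Suc i)))" for S :: "(nat \<Rightarrow> nat) set"
    by (intro continuous_on_compose2[OF g_cont] continuous_on_coordinatewise_then_product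
        continuous_on_subset[OF continuous_on_product_coordinates]) auto
  have "closed {\<alpha>::nat \<Rightarrow> nat. \<alpha> 0 = 0}"
    by (intro closed_Collect_eq continuous_on_product_coordinates continuous_on_const)
  moreover have "{\<alpha>::nat \<Rightarrow> nat. \<alpha> 0 \<noteq> 0} = - cyl [0]" by (auto simp: cyl_def)
  then have "closed {\<alpha>::nat \<Rightarrow> nat. \<alpha> 0 \<noteq> 0}" using open_cyl by (simp add: closed_Compl)
  moreover have "{\<alpha>::nat \<Rightarrow> nat. \<alpha> 0 = 0} \<union> {\<alpha>. \<alpha> 0 \<noteq> 0} = UNIV" by blast
  ultimately have "continuous_on ({\<alpha>. \<alpha> 0 = 0} \<union> {\<alpha>. \<alpha> 0 \<noteq> 0})
     (\<lambda>\<alpha>. if \<alpha> 0 = 0 then fst (g (\<lambda>i. \<alpha> (Suc i))) else snd (g (\<lambda>i. \<alpha> (Suc i))))"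
    by (intro continuous_on_If continuous_on_fst continuous_on_snd g') auto
  then show ?thesis unfolding p_def \<open>{\<alpha>::nat \<Rightarrow> nat. \<alpha> 0 = 0} \<union> {\<alpha>. \<alpha> 0 \<noteq> 0} = UNIV\<close> .
qed

lemma p_Field: "p \<alpha> \<in> Field G"
  using g_range unfolding p_def Field_def by (auto simp: Domain_fst Range_snd)

lemma ex_p:
  assumes "x \<in> Field G" shows "\<exists>\<alpha>. p \<alpha> = x"
proof -
  obtain \<beta> where "x = fst (g \<beta>) \<or> x = snd (g \<beta>)"
    using assms unfolding Field_def g_range[symmetric] Domain_fst Range_snd by blast
  then have "p (case_nat 0 \<beta>) = x \<or> p (case_nat 1 \<beta>) = x" by (auto simp: p_def)
  then show ?thesis by blast
qed

text \<open>An approximation \<open>h\<close> codes vertices through \<open>p\<close> and edges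
  through \<open>g\<close>; \<open>u\<close> prescribes the first \<open>n\<close> entries of all
  these codes. Edges have codes of their own because closeness of the ends to an edge of
  \<open>G\<close> would not put their limits into \<open>G\<close>.\<close>

definition approx ::
    "(nat \<Rightarrow> nat) \<Rightarrow> (nat \<Rightarrow> int list) \<Rightarrow> nat \<Rightarrow> (nat list \<times> nat list \<Rightarrow> nat list)
      \<Rightarrow> (nat list \<times> nat list \<Rightarrow> nat \<Rightarrow> nat) set" where
  "approx c d n u =
     {h. (\<forall>v w. (v, w) \<in> L_fin c d n \<longrightarrow> g (h (v, w)) = (p (h (v, v)), p (h (w, w)))) \<and>
         (\<forall>e\<in>cells c d n. map (h e) [0..<n] = u e)}"

lemma approx_cong:
  assumes "\<And>i. i \<le> n \<Longrightarrow> c i = c' i \<and> d i = d' i"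
  shows "approx c d n u = approx c' d' n u"
proof -
  have "L_fin c d n = L_fin c' d' n" "cells c d n = cells c' d' n"
    using L_fin_cong[of n c c' d d'] cells_cong[of n c c' d d'] assms by blast+
  then show ?thesis by (simp add: approx_def)
qed

lemma approx_edge:
  "h \<in> approx c d n u \<Longrightarrow> (v, w) \<in> L_fin c d n \<Longrightarrow> g (h (v, w)) = (p (h (v, v)), p (h (w, w)))"
  by (simp add: approx_def)

lemma approx_edge_in_G:
  "h \<in> approx c d n u \<Longrightarrow> (v, w) \<in> L_fin c d n \<Longrightarrow> (p (h (v, v)), p (h (w, w))) \<in> G"
  using approx_edge g_range by (metis rangeI)

lemma closed_approx: "closed (approx c d n u)"
proof -
  have "closed {h. map (h e) [0..<n] = u e}" for e :: "nat list \<times> nat list"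
  proof (cases "length (u e) = n")
    case True
    then have "{h. map (h e) [0..<n] = u e} = (\<lambda>h. h e) -` cyl (u e)"
      by (auto simp: cyl_def list_eq_iff_nth_eq)
    then show ?thesis by (simp add: closed_vimage closed_cyl)
  next
    case False
    have "map (h e) [0..<n] \<noteq> u e" for h :: "nat list \<times> nat list \<Rightarrow> nat \<Rightarrow> nat"
      using False by (metis diff_zero length_map length_upt)
    then have "{h. map (h e) [0..<n] = u e} = {}" by simp
    then show ?thesis by simp
  qed
  then have "closed (\<Inter>e\<in>cells c d n. {h. map (h e) [0..<n] = u e})" by blast
  moreover have "closed {h. g (h e) = (p (h (fst e, fst e)), p (h (snd e, snd e)))}"
    for e :: "nat list \<times> nat list"
    by (intro closed_Collect_eq continuous_on_Pair continuous_on_compose2[OF g_cont]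
        continuous_on_compose2[OF p_cont] continuous_on_product_coordinates) auto
  then have "closed (\<Inter>e\<in>L_fin c d n. {h. g (h e) = (p (h (fst e, fst e)), p (h (snd e, snd e)))})"
    by blast
  moreover have "approx c d n u =
      (\<Inter>e\<in>L_fin c d n. {h. g (h e) = (p (h (fst e, fst e)), p (h (snd e, snd e)))}) \<inter>
      (\<Inter>e\<in>cells c d n. {h. map (h e) [0..<n] = u e})"
    unfolding approx_def by auto
  ultimately show ?thesis by (simp add: closed_Int)
qed

definition points :: "(nat \<Rightarrow> nat) \<Rightarrow> (nat \<Rightarrow> int list) \<Rightarrow> nat \<Rightarrow> (nat list \<times> nat list \<Rightarrow> nat list) \<Rightarrow> 'a set" where
  "points c d n u = (\<lambda>h. p (h (s_seq c n, s_seq c n))) ` approx c d n u"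

lemma suslin_points: "suslin (points c d n u)"
  unfolding points_def
  by (rule suslin_image_closed[OF analytic_UNIV_fun closed_approx])
    (rule continuous_on_compose2[OF p_cont continuous_on_subset[OF continuous_on_product_coordinates]]; simp)

lemma points_subset: "points c d n u \<subseteq> Field G"
  unfolding points_def using p_Field by blast

text \<open>If all extensions gave small sets, a single invariant Borel set \<open>B\<close> would cover them. But
  \<open>points c d n u - B\<close> still contains the ends of an odd walk of large sum, and this walk joins two
  approximations to an extension that avoids \<open>B\<close>.\<close>

lemma extend_approx:
  fixes K :: int
  assumes b: "odd_pair c d" and ns: "\<not> small G (points c d n u)"
  shows "\<exists>c' d' u'. odd_pair c' d' \<and> (\<forall>i\<le>n. c' i = c i \<and> d' i = d i) \<and> K < sum_list (d' (Suc n)) \<and>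
    (\<forall>v w j. (v, w) \<in> cells c d n \<longrightarrow> j < 2 \<longrightarrow> take n (u' (v @ [j], w @ [j])) = u (v, w)) \<and>
    \<not> small G (points c' d' (Suc n) u')"
proof (rule ccontr)
  assume neg: "\<not> ?thesis"
  define c' where "c' C = c(Suc n := C)" for C
  define d' where "d' D = d(Suc n := D)" for D
  define ok where "ok C D u' \<longleftrightarrow> odd_pair (c' C) (d' D) \<and> K < sum_list D \<and>
    (\<forall>v w j. (v, w) \<in> cells c d n \<longrightarrow> j < 2 \<longrightarrow> take n (u' (v @ [j], w @ [j])) = u (v, w))" for C D u'
  \<comment> \<open>The maps \<open>u'\<close> are undefined outside the finitely many cells, which
    is what keeps the index set countable.\<close>
  define I where "I = (SIGMA C : UNIV. SIGMA D : UNIV.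
    {u'. ok C D u' \<and> u' \<in> (\<Pi>\<^sub>E e\<in>cells (c' C) (d' D) (Suc n). {l :: nat list. True})})"
  have small_ext: "small G (points (c' C) (d' D) (Suc n) u')" if "ok C D u'" for C D u'
  proof (rule ccontr)
    assume "\<not> small G (points (c' C) (d' D) (Suc n) u')"
    with neg[unfolded not_ex, THEN spec[of _ "c' C"], THEN spec[of _ "d' D"], THEN spec[of _ u']] that
    show False unfolding ok_def c'_def d'_def by auto
  qed
  have "countable I"
  proof -
    have "countable {u'. ok C D u' \<and> u' \<in> (\<Pi>\<^sub>E e\<in>cells (c' C) (d' D) (Suc n). {l :: nat list. True})}" for C D
    proof (cases "odd_pair (c' C) (d' D)")
      case True
      then have "countable (\<Pi>\<^sub>E e\<in>cells (c' C) (d' D) (Suc n). {l :: nat list. True})"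
        by (intro countable_PiE finite_cells) auto
      then show ?thesis by (rule countable_subset[rotated]) blast
    next
      case False
      then show ?thesis by (simp add: ok_def)
    qed
    then show ?thesis unfolding I_def by (intro countable_SIGMA) auto
  qed
  then have "small G (\<Union>(C, D, u')\<in>I. points (c' C) (d' D) (Suc n) u')"
    by (rule small_UN) (auto simp: I_def intro: small_ext)
  then obtain E F where EF: "borel_bipartition G E F"
    "(\<Union>(C, D, u')\<in>I. points (c' C) (d' D) (Suc n) u') \<subseteq> E \<union> F" unfolding small_def by blast
  define B where "B = E \<union> F"
  have B: "B \<in> sets borel" using EF(1) unfolding B_def borel_bipartition_def by blast
  have Bedge: "x \<in> B \<longleftrightarrow> y \<in> B" if "(x, y) \<in> G" for x y
    unfolding B_def by (rule borel_bipartition_edge[OF EF(1) that])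
  have "\<not> small G (points c d n u - B)" using small_split[OF EF(1)] ns unfolding B_def by blast
  from odd_walk_if_not_small[OF suslin_G suslin_Diff_borel[OF suslin_points B] _ this, of K]
  obtain x y l where l: "x \<in> points c d n u - B" "y \<in> points c d n u - B" "walk G x l y"
    "odd (length l)" "3 \<le> length l" "K < sum_list l" using points_subset by blast
  obtain q where q: "q 0 = x" "q (length l) = y"
    "\<And>i. i < length l \<Longrightarrow> pair_pow (q i, q (Suc i)) (l ! i) \<in> G"
    using walk_vertices[OF l(3)] by blast
  let ?s = "s_seq c n"
  obtain h\<^sub>0 h\<^sub>1 where h: "h\<^sub>0 \<in> approx c d n u" "x = p (h\<^sub>0 (?s, ?s))" "h\<^sub>1 \<in> approx c d n u" "y = p (h\<^sub>1 (?s, ?s))"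
    using l(1,2) unfolding points_def by blast
  define H where "H j = (if j = (0::nat) then h\<^sub>0 else h\<^sub>1)" for j
  have H: "H j \<in> approx c d n u" for j using h by (simp add: H_def)
  \<comment> \<open>Of the \<open>C + 2\<close> edges of the walk, \<open>C\<close> form the new
    path and two join its ends to the copies of \<open>?s\<close>.\<close>
  define C where "C = length l - 2"
  let ?c = "c' C" and ?d = "d' l"
  have C: "length l = C + 2" using l(5) by (simp add: C_def)
  have "odd C" using l(4) C by simp
  then have b': "odd_pair ?c ?d"
    using b C walk_signs[OF l(3)] by (auto simp: odd_pair_def c'_def d'_def)
  have old: "X_fin ?c n = X_fin c n" "L_fin ?c ?d n = L_fin c d n" "cells ?c ?d n = cells c d n"
    "s_seq ?c n = ?s"
    by (auto intro!: X_fin_cong L_fin_cong cells_cong s_seq_cong simp: c'_def d'_def)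
  \<comment> \<open>Only the inner vertices \<open>q 1\<close> to \<open>q (C + 1)\<close> are
    assigned to the path: \<open>q 0\<close> and \<open>q (C + 2)\<close> are \<open>x\<close> and
    \<open>y\<close>, the images of the two copies of \<open>?s\<close>. Length at least 2
    identifies a copied vertex.\<close>
  define X where "X v = (if 2 \<le> length v then p (H (last v) (butlast v, butlast v)) else q (Suc (hd v)))" for v
  \<comment> \<open>Copied cells keep their codes, so their prefixes continue those in
    \<open>u\<close>; a new cell takes any code of its vertex or edge. The test \<open>v = w\<close>
    separates the two kinds because, \<open>G\<close> being irreflexive, no edge has equal
    ends.\<close>
  define h' where "h' e = (case e of (v, w) \<Rightarrow>
    if 2 \<le> length v \<and> 2 \<le> length w \<and> last v = last w then H (last v) (butlast v, butlast w)
    else if v = w then SOME \<alpha>. p \<alpha> = X v else SOME \<alpha>. g \<alpha> = (X v, X w))" for e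
  have h'_copy: "h' (v @ [j], w @ [j]) = H j (v, w)" if "v \<noteq> []" "w \<noteq> []" for v w j
    using that by (cases v; cases w) (auto simp: h'_def)
  have X_copy: "X (v @ [j]) = p (H j (v, v))" if "v \<noteq> []" for v j
    using that by (cases v) (auto simp: X_def)
  have X_path: "X [k] = q (Suc k)" for k by (simp add: X_def)
  have sne: "?s \<noteq> []" by (simp add: s_seq_def)
  have edge: "(X v, X w) \<in> G" if "(v, w) \<in> L_fin ?c ?d (Suc n)" for v w
  proof -
    have pp: "(X v, X w) = pair_pow (X a, X b) e" if "(v, w) = pair_pow (a, b) e" for a b e
      using that by (auto simp: pair_pow_def split: if_splits)
    from that consider
      (copy) v' w' j where "(v', w') \<in> L_fin c d n" "v = v' @ [j]" "w = w' @ [j]"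
      | (path) i where "i < C" "(v, w) = pair_pow ([i], [Suc i]) (l ! Suc i)"
      | (first) "(v, w) = pair_pow (?s @ [0], [0]) (l ! 0)"
      | (last) "(v, w) = pair_pow ([C], ?s @ [1]) (l ! Suc C)"
      by (auto simp: old L_path_def) (auto simp: c'_def d'_def)
    then show ?thesis
    proof cases
      case copy
      then have "v' \<noteq> []" "w' \<noteq> []" using L_fin_subset[OF b] X_fin_nonempty by blast+
      then show ?thesis using copy approx_edge_in_G[OF H copy(1)] by (simp add: X_copy)
    next
      case path
      then show ?thesis using q(3)[of "Suc i"] C by (simp add: pp X_path)
    next
      case first
      have "X (?s @ [0]) = q 0" using h q(1) sne by (simp add: X_copy H_def)
      then show ?thesis using q(3)[of 0] C by (simp add: pp[OF first] X_path)
    next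
      case last
      have "X (?s @ [1]) = q (length l)" using h q(2) sne by (simp add: X_copy H_def)
      then show ?thesis using q(3)[of "Suc C"] C by (simp add: pp[OF last] X_path)
    qed
  qed
  have vertex: "p (h' (v, v)) = X v" if "v \<in> X_fin ?c (Suc n)" for v
    using that
  proof (cases rule: X_fin_Suc_cases)
    case (copy w j)
    then show ?thesis using X_fin_nonempty[OF copy(1)] by (simp add: h'_copy X_copy)
  next
    case (path k)
    then have "k \<le> C" by (simp add: c'_def)
    then have "pair_pow (q (Suc k), q (Suc (Suc k))) (l ! Suc k) \<in> G" using q(3)[of "Suc k"] C by simp
    then have "q (Suc k) \<in> Field G" by (auto simp: Field_def pair_pow_def split: if_splits)
    then have "\<exists>\<alpha>. p \<alpha> = X v" using ex_p path(2) by (simp add: X_path)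
    from someI_ex[OF this] show ?thesis using path(2) by (simp add: h'_def)
  qed
  have edge_code: "g (h' (v, w)) = (X v, X w)" if vw: "(v, w) \<in> L_fin ?c ?d (Suc n)" for v w
    using vw
  proof (cases rule: L_fin_Suc_cases)
    case (copy v' w' j)
    then have e: "(v', w') \<in> L_fin c d n" by (simp add: old)
    then have "v' \<noteq> []" "w' \<noteq> []" using L_fin_subset[OF b] X_fin_nonempty by blast+
    moreover have "g (H j (v', w')) = (p (H j (v', v')), p (H j (w', w')))"
      using H[of j] e by (simp add: approx_def)
    ultimately show ?thesis using copy by (simp add: h'_copy X_copy)
  next
    case path
    have "v \<noteq> w" using edge[OF vw] irr by (auto simp: irrefl_def)
    moreover have "\<exists>\<alpha>. g \<alpha> = (X v, X w)" using edge[OF vw] g_range by (metis rangeE)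
    from someI_ex[OF this] show ?thesis using path \<open>v \<noteq> w\<close> by (auto simp: h'_def)
  qed
  define u' where "u' = (\<lambda>e\<in>cells ?c ?d (Suc n). map (h' e) [0..<Suc n])"
  have "h' \<in> approx ?c ?d (Suc n) u'"
    unfolding approx_def
  proof (intro CollectI conjI allI impI ballI)
    fix v w assume vw: "(v, w) \<in> L_fin ?c ?d (Suc n)"
    then have "v \<in> X_fin ?c (Suc n)" "w \<in> X_fin ?c (Suc n)" using L_fin_subset[OF b'] by blast+
    then show "g (h' (v, w)) = (p (h' (v, v)), p (h' (w, w)))" by (simp only: edge_code[OF vw] vertex)
  qed (simp add: u'_def)
  then have pt: "p (h' (s_seq ?c (Suc n), s_seq ?c (Suc n))) \<in> points ?c ?d (Suc n) u'"
    unfolding points_def by blast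
  have "ok C l u'" unfolding ok_def
  proof (intro conjI allI impI)
    fix v w j assume vw: "(v, w) \<in> cells c d n" "j < (2::nat)"
    then have "v \<noteq> []" "w \<noteq> []" using cells_subset[OF b] X_fin_nonempty by blast+
    moreover have "(v @ [j], w @ [j]) \<in> cells ?c ?d (Suc n)"
      using vw old by (intro cells_snoc) auto
    ultimately have "u' (v @ [j], w @ [j]) = map (H j (v, w)) [0..<Suc n]"
      by (simp add: u'_def h'_copy)
    then have "take n (u' (v @ [j], w @ [j])) = map (H j (v, w)) [0..<n]" by simp
    then show "take n (u' (v @ [j], w @ [j])) = u (v, w)"
      using H[of j] vw(1) by (simp add: approx_def)
  qed (use b' l in auto)
  then have "(C, l, u') \<in> I" unfolding I_def u'_def by auto
  then have "p (h' (s_seq ?c (Suc n), s_seq ?c (Suc n))) \<in> B"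
    using EF(2) pt unfolding B_def by blast
  \<comment> \<open>The vertex \<open>s_seq\<close> of the new level is \<open>r @ [1]\<close>, in
    the copy governed by \<open>h\<^sub>1\<close>. That copy also contains \<open>?s @ [1]\<close>,
    which is sent to \<open>y\<close> outside \<open>B\<close>; as the graph is connected and
    \<open>B\<close> invariant, the image of \<open>r @ [1]\<close> avoids \<open>B\<close>
    too.\<close>
  moreover define r where "r = replicate (Suc n) (0::nat)"
  have "s_seq ?c (Suc n) = r @ [1]" by (simp add: s_seq_def r_def)
  moreover have "r \<noteq> []" by (simp add: r_def)
  ultimately have "p (h\<^sub>1 (r, r)) \<in> B" by (simp add: h'_copy H_def)
  moreover have "r \<in> X_fin c n" unfolding X_fin_def r_def
    by (rule UN_I[of 0]) auto
  have "(p (h\<^sub>1 (r, r)) \<in> B) = (p (h\<^sub>1 (?s, ?s)) \<in> B)"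
    by (rule L_fin_const[OF b _ \<open>r \<in> X_fin c n\<close>, of "\<lambda>v. p (h\<^sub>1 (v, v)) \<in> B"])
      (rule Bedge[OF approx_edge_in_G[OF h(3)]])
  ultimately show False using h(4) l(2) by blast
qed

text \<open>At level 0 this graph is a single edge and no prefix is fixed, so \<open>points\<close>
  consists of the targets of all edges. An invariant set containing these contains both ends of
  every edge, and its bipartition colors all of \<open>G\<close>.\<close>

lemma start_approx:
  assumes "\<not> (\<exists>A\<in>sets borel. \<forall>(x, y)\<in>G. x \<in> A \<longleftrightarrow> y \<notin> A)"
  shows "\<not> small G (points (\<lambda>_. 1) (\<lambda>_. [1, 1, 1]) 0 (\<lambda>_. []))"
proof
  assume "small G (points (\<lambda>_. 1) (\<lambda>_. [1, 1, 1]) 0 (\<lambda>_. []))"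
  then obtain D E where DE: "borel_bipartition G D E" "points (\<lambda>_. 1) (\<lambda>_. [1, 1, 1]) 0 (\<lambda>_. []) \<subseteq> D \<union> E"
    unfolding small_def by blast
  have L: "L_fin (\<lambda>_. 1) (\<lambda>_. [1, 1, 1]) 0 = {([0], [1])}"
    by (auto simp: L_path_def pair_pow_def)
  have "x \<in> D \<longleftrightarrow> y \<notin> D" if xy: "(x, y) \<in> G" for x y
  proof -
    have "x \<in> Field G" "y \<in> Field G" using xy by (auto simp: Field_def)
    then obtain \<alpha> \<beta> where "p \<alpha> = x" "p \<beta> = y" using ex_p by metis
    moreover obtain \<gamma> where "g \<gamma> = (x, y)" using xy g_range by (metis rangeE)
    ultimately have codes: "p \<alpha> = x" "p \<beta> = y" "g \<gamma> = (x, y)" .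
    define h where "h e = (if e = ([0], [0]) then \<alpha> else if e = ([1], [1]) then \<beta> else \<gamma>)"
      for e :: "nat list \<times> nat list"
    have "h \<in> approx (\<lambda>_. 1) (\<lambda>_. [1, 1, 1]) 0 (\<lambda>_. [])"
      unfolding approx_def L using codes by (simp add: h_def)
    then have "p (h ([1], [1])) \<in> D \<union> E"
      using DE(2) unfolding points_def image_subset_iff by (simp add: s_seq_def)
    then have "y \<in> D \<union> E" using codes by (simp add: h_def)
    then show ?thesis using DE(1) xy unfolding borel_bipartition_def by blast
  qed
  moreover have "D \<in> sets borel" using DE(1) by (simp add: borel_bipartition_def)
  ultimately have "\<exists>A\<in>sets borel. \<forall>(x, y)\<in>G. x \<in> A \<longleftrightarrow> y \<notin> A"
    by (intro bexI[of _ D]) auto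
  with assms show False ..
qed

text \<open>\<open>T\<close> treats vertices, as pairs \<open>(x, x)\<close>, and edges of the limit
  graph alike: the prefixes given by \<open>u\<close> along their projections cohere to a code
  \<open>z x y\<close>. At every level some approximation satisfies the edge equation for codes with
  these prefixes, so the equation holds for the limit codes.\<close>

lemma limit_hom:
  assumes b: "odd_pair c d" and ne: "\<And>n. approx c d n (u n) \<noteq> {}"
    and coh: "\<And>n v w j. (v, w) \<in> cells c d n \<Longrightarrow> j < 2 \<Longrightarrow> take n (u (Suc n) (v @ [j], w @ [j])) = u n (v, w)"
  shows "continuous_hom_from_L c d G"
proof -
  define T where "T = {(x, y). x \<in> X_lim c \<and> y \<in> X_lim c \<and>
    (\<forall>n\<ge>max (fst x) (fst y). (proj n x, proj n y) \<in> cells c d n)}"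
  define U where "U n x y = u n (proj n x, proj n y)" for n x y
  \<comment> \<open>Prefixes at level \<open>n\<close> have length \<open>n\<close>, so entry
    \<open>i\<close> exists from level \<open>Suc i\<close> on, provided that both points are born
    by then.\<close>
  define z where "z x y i = U (max (Suc i) (max (fst x) (fst y))) x y ! i" for x y i
  have len: "length (u n e) = n" if "e \<in> cells c d n" for n e
  proof -
    obtain h where "h \<in> approx c d n (u n)" using ne by blast
    then have "map (h e) [0..<n] = u n e" using that by (simp add: approx_def)
    then show ?thesis by (metis diff_zero length_map length_upt)
  qed
  have U_take: "take n (U N x y) = U n x y"
    if xy: "(x, y) \<in> T" and n: "max (fst x) (fst y) \<le> n" "n \<le> N" for x y n N
    using n(2)
  proof (induction N rule: dec_induct)
    case base
    have "(proj n x, proj n y) \<in> cells c d n" using xy n(1) by (auto simp: T_def)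
    then show ?case using len unfolding U_def by simp
  next
    case (step N)
    have cN: "(proj N x, proj N y) \<in> cells c d N" "(proj (Suc N) x, proj (Suc N) y) \<in> cells c d (Suc N)"
      using xy n(1) step(1) by (auto simp: T_def)
    obtain j where "j < 2" "proj (Suc N) x = proj N x @ [j]" "proj (Suc N) y = proj N y @ [j]"
      using cells_proj_Suc[OF _ _ _ _ cN(2)] xy n(1) step(1) by (auto simp: T_def)
    then have "take N (U (Suc N) x y) = U N x y" unfolding U_def using coh[OF cN(1)] by simp
    then have "take n (take N (U (Suc N) x y)) = U n x y" using step by simp
    then show ?case using step(1) by (simp add: min_def split: if_splits)
  qed
  have z: "map (z x y) [0..<n] = U n x y" if xy: "(x, y) \<in> T" and n: "max (fst x) (fst y) \<le> n" for x y n
  proof (rule nth_equalityI)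
    have "(proj n x, proj n y) \<in> cells c d n" using xy n by (auto simp: T_def)
    then show l: "length (map (z x y) [0..<n]) = length (U n x y)" using len by (simp add: U_def)
    fix i assume "i < length (map (z x y) [0..<n])"
    then have i: "i < n" by simp
    let ?m = "max (Suc i) (max (fst x) (fst y))"
    have "take ?m (U n x y) = U ?m x y" using i n by (intro U_take[OF xy]) auto
    moreover have "take ?m (U n x y) ! i = U n x y ! i" by simp
    ultimately show "map (z x y) [0..<n] ! i = U n x y ! i" using i by (simp add: z_def)
  qed
  have diag: "(x, x) \<in> T" if "x \<in> X_lim c" for x
    using that proj_in_X_fin by (auto simp: T_def cells_def)
  have edge: "(x, y) \<in> T" if "(x, y) \<in> L_lim c d" for x y
    using that by (auto simp: T_def L_lim_def cells_def)
  define \<phi> where "\<phi> x = p (z x x)" for x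
  \<comment> \<open>Entry \<open>i\<close> depends on the first two coordinates of \<open>x\<close>
    and on finitely many digits, also off \<open>X_lim c\<close>; hence it is locally
    constant.\<close>
  have "continuous_on UNIV (\<lambda>x. z x x)"
  proof (rule continuous_on_coordinatewise_then_product)
    fix i
    show "continuous_on UNIV (\<lambda>x. z x x i)"
      unfolding continuous_on_open_vimage[OF open_UNIV]
    proof (intro allI impI)
      fix B :: "nat set"
      have "\<exists>W. open W \<and> x \<in> W \<and> W \<subseteq> (\<lambda>x. z x x i) -` B" if x: "z x x i \<in> B" for x
      proof -
        obtain m k r where mkr: "x = (m, k, r)" by (cases x)
        let ?N = "max (Suc i) m"
        let ?W = "{m} \<times> {k} \<times> {r'. \<forall>i<?N - m. r' i = r i}"
        have "z x' x' i = z x x i" if x': "x' \<in> ?W" for x'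
        proof -
          have "proj ?N x' = proj ?N x" "fst x' = m" using x' by (auto simp: mkr proj_def)
          then show ?thesis by (simp add: z_def U_def mkr)
        qed
        then have "?W \<subseteq> (\<lambda>x. z x x i) -` B" using x by auto
        moreover have "open ?W"
          by (intro open_Times open_agree) (auto intro: open_discrete)
        moreover have "x \<in> ?W" by (simp add: mkr)
        ultimately show ?thesis by blast
      qed
      then show "open ((\<lambda>x. z x x i) -` B \<inter> UNIV)"
        by (subst open_subopen) auto
    qed
  qed
  then have "continuous_on UNIV \<phi>" unfolding \<phi>_def
    by (intro continuous_on_compose2[OF p_cont]) auto
  moreover have "(\<phi> x, \<phi> y) \<in> G" if xy: "(x, y) \<in> L_lim c d" for x y
  proof -
    have X: "x \<in> X_lim c" "y \<in> X_lim c" using xy by (auto simp: L_lim_def)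
    have app: "\<exists>h. map (h (proj n x, proj n y)) [0..<n] = map (z x y) [0..<n] \<and>
        map (h (proj n x, proj n x)) [0..<n] = map (z x x) [0..<n] \<and>
        map (h (proj n y, proj n y)) [0..<n] = map (z y y) [0..<n] \<and>
        g (h (proj n x, proj n y)) = (p (h (proj n x, proj n x)), p (h (proj n y, proj n y)))"
      if n: "max (fst x) (fst y) \<le> n" for n
    proof -
      obtain h where h: "h \<in> approx c d n (u n)" using ne by blast
      have hU: "map (h (proj n a, proj n b)) [0..<n] = map (z a b) [0..<n]"
        if "(a, b) \<in> T" "max (fst a) (fst b) \<le> n" for a b
        using h that z[OF that] by (auto simp: approx_def T_def U_def)
      have "(proj n x, proj n y) \<in> L_fin c d n" using xy n by (auto simp: L_lim_def)
      then have "g (h (proj n x, proj n y)) = (p (h (proj n x, proj n x)), p (h (proj n y, proj n y)))"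
        using h by (auto simp: approx_def)
      then show ?thesis using hU[OF edge[OF xy]] hU[OF diag[OF X(1)]] hU[OF diag[OF X(2)]] n by auto
    qed
    have "fst (g (z x y)) = \<phi> x" unfolding \<phi>_def
    proof (rule limit_point_eqI[OF continuous_on_fst[OF g_cont] p_cont])
      fix N
      show "\<exists>n\<ge>N. \<exists>\<alpha>' \<beta>'. map \<alpha>' [0..<n] = map (z x y) [0..<n] \<and>
        map \<beta>' [0..<n] = map (z x x) [0..<n] \<and> fst (g \<alpha>') = p \<beta>'"
        using app[of "max N (max (fst x) (fst y))"]
        by (intro exI[of _ "max N (max (fst x) (fst y))"] conjI max.cobounded1) (metis fst_conv max.cobounded2)
    qed
    moreover have "snd (g (z x y)) = \<phi> y" unfolding \<phi>_def
    proof (rule limit_point_eqI[OF continuous_on_snd[OF g_cont] p_cont])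
      fix N
      show "\<exists>n\<ge>N. \<exists>\<alpha>' \<beta>'. map \<alpha>' [0..<n] = map (z x y) [0..<n] \<and>
        map \<beta>' [0..<n] = map (z y y) [0..<n] \<and> snd (g \<alpha>') = p \<beta>'"
        using app[of "max N (max (fst x) (fst y))"]
        by (intro exI[of _ "max N (max (fst x) (fst y))"] conjI max.cobounded1) (metis snd_conv max.cobounded2)
    qed
    ultimately have "g (z x y) = (\<phi> x, \<phi> y)" by (simp add: prod_eq_iff)
    then show ?thesis using g_range by (metis rangeI)
  qed
  ultimately show ?thesis unfolding continuous_hom_from_L_def digraph_hom_def
    by (intro exI[of _ \<phi>] conjI) (auto intro: continuous_on_subset)
qed

text \<open>Every stage carries total functions \<open>c\<close> and \<open>d\<close>, of which only
  the entries up to \<open>n\<close> are final; the pair sought is the diagonal. The bound demanded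
  of the next walk is computed from the sums already fixed.\<close>

lemma ex_odd_pair_hom:
  fixes f :: "nat \<Rightarrow> nat"
  assumes "\<not> (\<exists>A\<in>sets borel. \<forall>(x, y)\<in>G. x \<in> A \<longleftrightarrow> y \<notin> A)"
  shows "\<exists>c d. odd_pair c d \<and> continuous_hom_from_L c d G \<and>
    (\<forall>i. sum_list (d i) > int (f i) * (\<Sum>j<i. \<bar>sum_list (d j)\<bar>))"
proof -
  define P where "P n t \<longleftrightarrow> (case t of (c, d, u) \<Rightarrow> odd_pair c d \<and> \<not> small G (points c d n u) \<and>
    (n = 0 \<longrightarrow> 0 < sum_list (d 0)))" for n :: nat and t
  define Q where "Q n t t' \<longleftrightarrow> (case t of (c, d, u) \<Rightarrow> case t' of (c', d', u') \<Rightarrow>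
    (\<forall>i\<le>n. c' i = c i \<and> d' i = d i) \<and>
    int (f (Suc n)) * (\<Sum>j<Suc n. \<bar>sum_list (d j)\<bar>) < sum_list (d' (Suc n)) \<and>
    (\<forall>v w j. (v, w) \<in> cells c d n \<longrightarrow> j < 2 \<longrightarrow> take n (u' (v @ [j], w @ [j])) = u (v, w)))"
    for n and t t' :: "(nat \<Rightarrow> nat) \<times> (nat \<Rightarrow> int list) \<times> (nat list \<times> nat list \<Rightarrow> nat list)"
  have "\<exists>F. \<forall>n. P n (F n) \<and> Q n (F n) (F (Suc n))"
  proof (rule dependent_nat_choice)
    \<comment> \<open>The sum 3 of the initial list is positive, as required at
      \<open>i = 0\<close>, where the sum over smaller indices is empty.\<close>
    show "\<exists>t. P 0 t"
      using start_approx[OF assms]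
      by (intro exI[of _ "(\<lambda>_. 1, \<lambda>_. [1, 1, 1], \<lambda>_. [])"]) (auto simp: P_def odd_pair_def)
  next
    fix t n assume "P n t"
    then obtain c d u where t: "t = (c, d, u)" "odd_pair c d" "\<not> small G (points c d n u)"
      by (auto simp: P_def)
    from extend_approx[OF t(2,3), of "int (f (Suc n)) * (\<Sum>j<Suc n. \<bar>sum_list (d j)\<bar>)"]
    obtain c' d' u' where "odd_pair c' d'" "\<forall>i\<le>n. c' i = c i \<and> d' i = d i"
      "int (f (Suc n)) * (\<Sum>j<Suc n. \<bar>sum_list (d j)\<bar>) < sum_list (d' (Suc n))"
      "\<forall>v w j. (v, w) \<in> cells c d n \<longrightarrow> j < 2 \<longrightarrow> take n (u' (v @ [j], w @ [j])) = u (v, w)"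
      "\<not> small G (points c' d' (Suc n) u')" by blast
    then show "\<exists>t'. P (Suc n) t' \<and> Q n t t'"
      by (intro exI[of _ "(c', d', u')"]) (simp add: P_def Q_def t)
  qed
  then obtain F where F: "\<And>n. P n (F n)" "\<And>n. Q n (F n) (F (Suc n))" by blast
  define cs ds us where "cs n = fst (F n)" and "ds n = fst (snd (F n))" and "us n = snd (snd (F n))" for n
  have P: "odd_pair (cs n) (ds n)" "\<not> small G (points (cs n) (ds n) n (us n))" for n
    using F(1)[of n] by (auto simp: P_def cs_def ds_def us_def split: prod.splits)
  have P0: "0 < sum_list (ds 0 0)"
    using F(1)[of 0] by (auto simp: P_def ds_def split: prod.splits)
  have Q: "\<And>i. i \<le> n \<Longrightarrow> cs (Suc n) i = cs n i \<and> ds (Suc n) i = ds n i"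
    "int (f (Suc n)) * (\<Sum>j<Suc n. \<bar>sum_list (ds n j)\<bar>) < sum_list (ds (Suc n) (Suc n))"
    "\<And>v w j. (v, w) \<in> cells (cs n) (ds n) n \<Longrightarrow> j < 2 \<Longrightarrow>
      take n (us (Suc n) (v @ [j], w @ [j])) = us n (v, w)" for n
    using F(2)[of n] by (auto simp: Q_def cs_def ds_def us_def split: prod.splits)
  define c d where "c n = cs n n" and "d n = ds n n" for n
  have lim: "c i = cs n i \<and> d i = ds n i" if "i \<le> n" for i n
    using that
  proof (induction n rule: dec_induct)
    case (step n)
    then show ?case using Q(1)[of i n] by simp
  qed (simp add: c_def d_def)
  have b: "odd_pair c d"
    using P(1) unfolding odd_pair_def c_def d_def by blast
  have "continuous_hom_from_L c d G"
  proof (rule limit_hom[OF b])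
    fix n
    have "approx (cs n) (ds n) n (us n) \<noteq> {}"
      using P(2)[of n] small_empty[of G] unfolding points_def by auto
    then show "approx c d n (us n) \<noteq> {}" using approx_cong[of n c "cs n" d "ds n", OF lim] by simp
    show "take n (us (Suc n) (v @ [j], w @ [j])) = us n (v, w)" if "(v, w) \<in> cells c d n" "j < 2" for v w j
      using that Q(3)[of v w n j] cells_cong[of n c "cs n" d "ds n", OF lim] by simp
  qed
  moreover have "sum_list (d i) > int (f i) * (\<Sum>j<i. \<bar>sum_list (d j)\<bar>)" for i
  proof (cases i)
    case 0
    then show ?thesis using P0 by (simp add: d_def)
  next
    case (Suc n)
    have "(\<Sum>j<Suc n. \<bar>sum_list (d j)\<bar>) = (\<Sum>j<Suc n. \<bar>sum_list (ds n j)\<bar>)"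
      by (rule sum.cong) (simp_all add: lim[of _ n])
    then show ?thesis using Q(2)[of n] Suc by (simp add: d_def)
  qed
  ultimately show ?thesis using b by blast
qed

end

theorem theorem3p1:
  fixes G :: "'a::t2_space digraph"
  assumes "irrefl G" and "analytic_set G"
  shows "(borel_chromatic_number_le G 2 \<longleftrightarrow>
            \<not> (\<exists>c d. odd_pair c d \<and> continuous_hom_from_L c d G)) \<and>
         ((\<exists>c d. odd_pair c d \<and> continuous_hom_from_L c d G) \<longrightarrow>
            (\<forall>f :: nat \<Rightarrow> nat. \<exists>c d. odd_pair c d \<and> continuous_hom_from_L c d G \<and>
               (\<forall>i. sum_list (d i) > int (f i) * (\<Sum>j<i. \<bar>sum_list (d j)\<bar>))))"
proof -
  obtain g :: "(nat \<Rightarrow> nat) \<Rightarrow> 'a \<times> 'a" where g: "continuous_on UNIV g" "range g = G"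
    using assms(2) unfolding analytic_set_def by blast
  interpret coded_digraph G g by unfold_locales (use g assms(1) in auto)
  \<comment> \<open>A continuous image of the whole Baire space is nonempty, so \<open>G\<close> has
    an edge.\<close>
  have "G \<noteq> {}" using g(2) by blast
  note iff = borel_chromatic_number_le_2_iff[OF this]
  have no: "\<not> (\<exists>A\<in>sets borel. \<forall>(x, y)\<in>G. x \<in> A \<longleftrightarrow> y \<notin> A)"
    if cd: "odd_pair c d" "continuous_hom_from_L c d G" for c d
  proof
    assume "\<exists>A\<in>sets borel. \<forall>(x, y)\<in>G. x \<in> A \<longleftrightarrow> y \<notin> A"
    then obtain A where A: "A \<in> sets borel" "\<And>x y. (x, y) \<in> G \<Longrightarrow> x \<in> A \<longleftrightarrow> y \<notin> A" by blast
    obtain \<phi> where "continuous_on (X_lim c) \<phi>" "\<And>x y. (x, y) \<in> L_lim c d \<Longrightarrow> (\<phi> x, \<phi> y) \<in> G"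
      using cd(2) unfolding continuous_hom_from_L_def digraph_hom_def by blast
    then show False using L_lim_no_borel_bipartition[OF cd(1) _ A(1)] A(2) by blast
  qed
  show ?thesis
  proof (intro conjI impI allI)
    show "borel_chromatic_number_le G 2 \<longleftrightarrow> \<not> (\<exists>c d. odd_pair c d \<and> continuous_hom_from_L c d G)"
      unfolding iff using no ex_odd_pair_hom[of "\<lambda>_. 0"] by metis
    fix f :: "nat \<Rightarrow> nat"
    assume "\<exists>c d. odd_pair c d \<and> continuous_hom_from_L c d G"
    then have "\<not> (\<exists>A\<in>sets borel. \<forall>(x, y)\<in>G. x \<in> A \<longleftrightarrow> y \<notin> A)"
      using no by metis
    then show "\<exists>c d. odd_pair c d \<and> continuous_hom_from_L c d G \<and>
        (\<forall>i. sum_list (d i) > int (f i) * (\<Sum>j<i. \<bar>sum_list (d j)\<bar>))"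
      by (rule ex_odd_pair_hom)
  qed
qed

end
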